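(* Let $D\subset\mathbb{R}^2$ be a connected and simply connected domain with non-empty interior, bounded by a smooth closed curve $\gamma$. Let $F=(f,g):D\to D$ be a moderate symplectomorphism (so $f_xg_y-f_yg_x=1$) which is the identity on $\gamma$, and assume that $F$ has no conformal points on $\gamma$. Then $F$ possesses at least two conformal points in the interior of $D$, counted with multiplicity.
   Context: A symplectomorphism of $D$ is an area- and orientation-preserving diffeomorphism $D\to D$. $F$ is called moderate if its graph $G=\{(z,F(z))\}\subset\mathbb{C}^2$ is everywhere transverse to the fibers of the projection $\mathrm{pr}(z_1,z_2)=\big(\tfrac{z_1+z_2}{2},\tfrac{z_1+z_2}{2}\big)$, i.e. the tangent plane of $G$ at each point is complementary to the kernel of $d\,\mathrm{pr}$; equivalently $2+f_x+g_y\neq 0$ on $D$. A point is a conformal point of $F$ if $dF$ is a similarity there, i.e. $f_x=g_y$ and $f_y=-g_x$. Conformal points are the zeros of the vector field with components $(f_x-g_y,\ f_y+g_x)$ (expressed in the coordinates $w=\tfrac{z+F(z)}{2}$), and "counted with multiplicity" refers to the indices of these zeros, whose sum is asserted to be at least $2$. *)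

theory Defs
  imports "HOL-Complex_Analysis.Complex_Analysis"
begin

text \<open>The plane R^2 is identified with the complex numbers; a map F = (f,g) is a
  function complex to complex, f = Re o F, g = Im o F.\<close>

definition dir_deriv :: "complex \<Rightarrow> (complex \<Rightarrow> complex) \<Rightarrow> complex \<Rightarrow> complex" where
  "dir_deriv v F z = frechet_derivative F (at z) v"

fun iter_dir_deriv :: "complex list \<Rightarrow> (complex \<Rightarrow> complex) \<Rightarrow> complex \<Rightarrow> complex" where
  "iter_dir_deriv [] F = F"
| "iter_dir_deriv (v # vs) F = dir_deriv v (iter_dir_deriv vs F)"

text \<open>C^infinity on an open set U: all iterated partial derivatives exist (hence are continuous).\<close>
definition smooth_on :: "complex set \<Rightarrow> (complex \<Rightarrow> complex) \<Rightarrow> bool" where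
  "smooth_on U F \<longleftrightarrow> (\<forall>vs. set vs \<subseteq> {1, \<i>} \<longrightarrow> iter_dir_deriv vs F differentiable_on U)"

definition smooth_near :: "complex set \<Rightarrow> (complex \<Rightarrow> complex) \<Rightarrow> bool" where
  "smooth_near D F \<longleftrightarrow> (\<exists>U. open U \<and> D \<subseteq> U \<and> smooth_on U F)"

fun curve_deriv :: "nat \<Rightarrow> (real \<Rightarrow> complex) \<Rightarrow> real \<Rightarrow> complex" where
  "curve_deriv 0 \<gamma> = \<gamma>"
| "curve_deriv (Suc n) \<gamma> = (\<lambda>t. vector_derivative (curve_deriv n \<gamma>) (at t))"

definition smooth_simple_closed_curve :: "(real \<Rightarrow> complex) \<Rightarrow> bool" where
  "smooth_simple_closed_curve \<gamma> \<longleftrightarrow>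
     (\<forall>n t. curve_deriv n \<gamma> differentiable (at t)) \<and>
     (\<forall>t. vector_derivative \<gamma> (at t) \<noteq> 0) \<and>
     (\<forall>t. \<gamma> (t + 1) = \<gamma> t) \<and>
     inj_on \<gamma> {0..<1}"

definition f_x :: "(complex \<Rightarrow> complex) \<Rightarrow> complex \<Rightarrow> real" where
  "f_x F z = Re (dir_deriv 1 F z)"
definition f_y :: "(complex \<Rightarrow> complex) \<Rightarrow> complex \<Rightarrow> real" where
  "f_y F z = Re (dir_deriv \<i> F z)"
definition g_x :: "(complex \<Rightarrow> complex) \<Rightarrow> complex \<Rightarrow> real" where
  "g_x F z = Im (dir_deriv 1 F z)"
definition g_y :: "(complex \<Rightarrow> complex) \<Rightarrow> complex \<Rightarrow> real" where
  "g_y F z = Im (dir_deriv \<i> F z)"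

definition symplectomorphism :: "complex set \<Rightarrow> (complex \<Rightarrow> complex) \<Rightarrow> bool" where
  "symplectomorphism D F \<longleftrightarrow>
     bij_betw F D D \<and> smooth_near D F \<and>
     (\<exists>G. smooth_near D G \<and> (\<forall>z\<in>D. G (F z) = z \<and> F (G z) = z)) \<and>
     (\<forall>z\<in>D. f_x F z * g_y F z - f_y F z * g_x F z = 1)"

definition moderate :: "complex set \<Rightarrow> (complex \<Rightarrow> complex) \<Rightarrow> bool" where
  "moderate D F \<longleftrightarrow> (\<forall>z\<in>D. 2 + f_x F z + g_y F z \<noteq> 0)"

definition conformal_point :: "(complex \<Rightarrow> complex) \<Rightarrow> complex \<Rightarrow> bool" where
  "conformal_point F z \<longleftrightarrow> f_x F z = g_y F z \<and> f_y F z = - g_x F z"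

definition conf_field :: "(complex \<Rightarrow> complex) \<Rightarrow> complex \<Rightarrow> complex" where
  "conf_field F z = Complex (f_x F z - g_y F z) (f_y F z + g_x F z)"

definition wcoord :: "(complex \<Rightarrow> complex) \<Rightarrow> complex \<Rightarrow> complex" where
  "wcoord F z = (z + F z) / 2"

text \<open>Index of the (isolated) zero p of the vector field, computed in the coordinates w:
  the winding number around 0 of the field along a small positively oriented circle
  about w(p) in the w-plane (pulled back to a small loop c near p, which exists since
  w is a local diffeomorphism for moderate F). The value k is the one that is obtained
  for all sufficiently small radii.\<close>
definition conf_index :: "(complex \<Rightarrow> complex) \<Rightarrow> complex \<Rightarrow> int" where
  "conf_index F p = (THE k::int. \<exists>e>0. \<forall>r c. 0 < r \<and> r < e \<and> path c \<and>
       path_image c \<subseteq> ball p e \<and>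
       (\<forall>t\<in>{0..1}. wcoord F (c t) = wcoord F p + of_real r * exp (2 * pi * \<i> * of_real t)) \<longrightarrow>
       winding_number (conf_field F \<circ> c) 0 = of_int k)"

end

theory Submission
  imports Defs
begin

text \<open>Write \<open>dF(v) = a v + b cnj(v)\<close>; the field is \<open>2 b\<close>. Along the boundary \<open>dF\<close> fixes the
  tangent vector \<open>T\<close> and has determinant 1, which forces \<open>Re a = 1\<close> and
  \<open>b / T\<^sup>2 \<in> \<i>\<real>\<close>. Hence the field turns exactly twice as often as the tangent, that is,
  twice by Hopf's Umlaufsatz. Since the trace of \<open>dF\<close> is 2 on the boundary and never \<open>-2\<close>, the
  coordinate \<open>w\<close> preserves orientation, so the indices computed in it are the usual ones, and they
  add up to the winding number 2 of the field along the boundary. The Umlaufsatz is proved by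
  Hopf's secant map, started at a lowest point of the curve.\<close>

section \<open>Winding numbers and continuous logarithms\<close>

text \<open>Winding numbers are handled throughout as endpoint differences of continuous logarithms.
  The obstacle is that \<open>conf_index\<close> is measured along the preimage under w of a round
  circle, a curve without an explicit form in z. Deforming it into a round circle about p is
  avoided: the preimage of the whole w-disc serves as the neighbourhood in which the field is
  altered. The field divided by a power of z - p extends without zeros over that neighbourhood, so
  zeros can be removed one at a time. What remains is a nowhere vanishing field on D, and it has a
  logarithm because the complement of D is connected.

  Orientation is the second obstacle, since the given curve may run either way. It is replaced by a
  curve with the same image that starts at a lowest point and heads to the right. This choice fixes
  both signs at once: the turning number is +1, and so is the winding number about each inside
  point.\<close>

lemma constant_of_exp_constant:
  fixes f :: "'a::topological_space \<Rightarrow> complex"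
  assumes "connected S" "continuous_on S f" "\<And>x. x \<in> S \<Longrightarrow> exp (f x) = c" "x \<in> S" "y \<in> S"
  shows "f x = f y"
proof -
  have "f constant_on S"
  proof (rule continuous_discrete_range_constant[OF assms(1,2)])
    fix x assume x: "x \<in> S"
    show "\<exists>e>0. \<forall>y. y \<in> S \<and> f y \<noteq> f x \<longrightarrow> e \<le> norm (f y - f x)"
    proof (intro exI[of _ "2 * pi"] conjI allI impI)
      fix y assume y: "y \<in> S \<and> f y \<noteq> f x"
      then have "exp (f y) = exp (f x)" using assms(3) x by metis
      then obtain n where n: "f y = f x + of_int (2 * n) * pi * \<i>"
        by (auto simp: exp_eq)
      with y have "n \<noteq> 0" by auto
      then have "1 \<le> \<bar>real_of_int n\<bar>" by linarith
      then show "2 * pi \<le> norm (f y - f x)"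
        by (simp add: n norm_mult)
    qed auto
  qed
  then show ?thesis using assms(4,5) unfolding constant_on_def by metis
qed

text \<open>Two logarithms of the same path differ by a constant, so the increment of any given one
  may replace that of the library's. The path may be open.\<close>

lemma winding_number_exp_lift:
  assumes "continuous_on {0..1} q" "\<And>t. t \<in> {0..1} \<Longrightarrow> p t = exp (q t)"
  shows "winding_number p 0 = (q 1 - q 0) / (2 * of_real pi * \<i>)"
proof -
  have "continuous_on {0..1} (\<lambda>t. exp (q t))"
    by (intro continuous_intros assms)
  then have "path p" unfolding path_def
    by (rule continuous_on_cong[THEN iffD1, rotated 2]) (use assms(2) in auto)
  moreover have "0 \<notin> path_image p" using assms(2) by (auto simp: path_image_def)
  ultimately obtain r where r: "path r" 
    "pathfinish r - pathstart r = 2 * of_real pi * \<i> * winding_number p 0"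
    "\<And>t. t \<in> {0..1} \<Longrightarrow> p t = 0 + exp (r t)"
    using winding_number_as_continuous_log[of p 0] by metis
  have "r 1 - q 1 = r 0 - q 0"
  proof (rule constant_of_exp_constant[of "{0..1::real}" "\<lambda>t. r t - q t" 1])
    show "continuous_on {0..1} (\<lambda>t. r t - q t)"
      using r(1) assms(1) unfolding path_def by (intro continuous_intros)
    show "exp (r t - q t) = 1" if "t \<in> {0..1}" for t
      using r(3)[OF that] assms(2)[OF that] by (simp add: exp_diff)
  qed auto
  then have "q 1 - q 0 = 2 * of_real pi * \<i> * winding_number p 0"
    using r(2) by (simp add: pathfinish_def pathstart_def algebra_simps)
  then show ?thesis by simp
qed

lemma winding_number_exp_lift_loop:
  assumes "continuous_on {0..1} q" "\<And>t. t \<in> {0..1} \<Longrightarrow> p t = exp (q t)" "q 0 = q 1"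
  shows "winding_number p 0 = 0"
  using winding_number_exp_lift[OF assms(1,2)] assms(3) by simp

lemma exp_liftE:
  assumes "continuous_on {0..1} p" "\<And>t. t \<in> {0..1} \<Longrightarrow> p t \<noteq> 0"
  obtains q where "continuous_on {0..1} q" "\<And>t. t \<in> {0..1} \<Longrightarrow> p t = exp (q t)"
    "q 1 - q 0 = 2 * of_real pi * \<i> * winding_number p 0"
proof -
  have "path p" "0 \<notin> path_image p" using assms by (auto simp: path_def path_image_def)
  then show ?thesis using winding_number_as_continuous_log[of p 0] that
    by (metis (no_types, lifting) add_0 path_def pathfinish_def pathstart_def)
qed

lemma winding_number_mult:
  assumes "continuous_on {0..1} p" "\<And>t. t \<in> {0..1} \<Longrightarrow> p t \<noteq> 0"
    "continuous_on {0..1} q" "\<And>t. t \<in> {0..1} \<Longrightarrow> q t \<noteq> 0"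
  shows "winding_number (\<lambda>t. p t * q t) 0 = winding_number p 0 + winding_number q 0"
proof -
  obtain a where a: "continuous_on {0..1} a" "\<And>t. t \<in> {0..1} \<Longrightarrow> p t = exp (a t)"
    "a 1 - a 0 = 2 * of_real pi * \<i> * winding_number p 0"
    using exp_liftE[OF assms(1,2)] by blast
  obtain b where b: "continuous_on {0..1} b" "\<And>t. t \<in> {0..1} \<Longrightarrow> q t = exp (b t)"
    "b 1 - b 0 = 2 * of_real pi * \<i> * winding_number q 0"
    using exp_liftE[OF assms(3,4)] by blast
  have "winding_number (\<lambda>t. p t * q t) 0 = ((a 1 + b 1) - (a 0 + b 0)) / (2 * of_real pi * \<i>)"
    by (rule winding_number_exp_lift) (use a b in \<open>auto simp: exp_add intro!: continuous_intros\<close>)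
  also have "(a 1 + b 1) - (a 0 + b 0) = (a 1 - a 0) + (b 1 - b 0)" by simp
  finally show ?thesis unfolding a(3) b(3) distrib_left[symmetric] by simp
qed

lemma winding_number_powi:
  assumes "continuous_on {0..1} p" "\<And>t. t \<in> {0..1} \<Longrightarrow> p t \<noteq> 0"
  shows "winding_number (\<lambda>t. p t powi k) 0 = of_int k * winding_number p 0"
proof -
  obtain a where a: "continuous_on {0..1} a" "\<And>t. t \<in> {0..1} \<Longrightarrow> p t = exp (a t)"
    "a 1 - a 0 = 2 * of_real pi * \<i> * winding_number p 0"
    using exp_liftE[OF assms(1,2)] by blast
  have "winding_number (\<lambda>t. p t powi k) 0 = (of_int k * a 1 - of_int k * a 0) / (2 * of_real pi * \<i>)"
    by (rule winding_number_exp_lift) (use a in \<open>auto simp: exp_power_int intro!: continuous_intros\<close>)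
  also have "of_int k * a 1 - of_int k * a 0 = of_int k * (a 1 - a 0)" by (simp add: algebra_simps)
  finally show ?thesis unfolding a(3) by (simp add: field_simps)
qed

text \<open>The quotient \<open>p t / q t\<close> stays within distance 1 of 1, hence in the right
  half-plane, where \<open>Ln\<close> supplies a closed logarithm.\<close>

lemma winding_number_near_one:
  assumes p: "continuous_on {0..1} p" and q: "continuous_on {0..1} q" "\<And>t. t \<in> {0..1} \<Longrightarrow> q t \<noteq> 0"
    and close: "\<And>t. t \<in> {0..1} \<Longrightarrow> norm (p t - q t) < norm (q t)" and "p 0 = p 1" "q 0 = q 1"
  shows "winding_number p 0 = winding_number q 0"
proof -
  let ?r = "\<lambda>t. p t / q t"
  have re: "0 < Re (?r t)" if "t \<in> {0..1}" for t
  proof -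
    have "norm (?r t - 1) < 1"
      using close[OF that] q(2)[OF that] by (simp add: divide_simps norm_divide)
    moreover have "\<bar>Re (?r t - 1)\<bar> \<le> norm (?r t - 1)" by (rule abs_Re_le_cmod)
    ultimately have "\<bar>Re (?r t) - 1\<bar> < 1" by (simp del: Re_divide_of_real)
    then show ?thesis by linarith
  qed
  have cr: "continuous_on {0..1} ?r"
    using p q by (intro continuous_intros) auto
  have r0: "?r t \<noteq> 0" if "t \<in> {0..1}" for t using re[OF that] by (metis less_irrefl zero_complex.sel(1))
  have "winding_number ?r 0 = 0"
  proof (rule winding_number_exp_lift_loop)
    show "continuous_on {0..1} (\<lambda>t. Ln (?r t))"
    proof (intro continuous_on_Ln' cr)
      show "?r t \<notin> \<real>\<^sub>\<le>\<^sub>0" if "t \<in> {0..1}" for t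
        using re[OF that] by (metis complex_nonpos_Reals_iff not_less)
    qed
    show "?r t = exp (Ln (?r t))" if "t \<in> {0..1}" for t using r0[OF that] by simp
  qed (use assms in auto)
  moreover have "winding_number p 0 = winding_number (\<lambda>t. ?r t * q t) 0"
    by (rule winding_number_cong) (use q(2) in auto)
  ultimately show ?thesis using winding_number_mult[OF cr r0 q] by simp
qed

section \<open>The index sum of a planar vector field\<close>

text \<open>The index of \<open>V\<close> at \<open>p\<close> is \<open>k\<close>, phrased without curves: on the boundary of arbitrarily small
  neighbourhoods, \<open>V / (z - p)\<^sup>k\<close> agrees with a field that has no zeros inside.\<close>
definition fillable :: "(complex \<Rightarrow> complex) \<Rightarrow> complex \<Rightarrow> int \<Rightarrow> bool" where
  "fillable V p k \<longleftrightarrow> (\<forall>e>0. \<exists>B G. open B \<and> p \<in> B \<and> closure B \<subseteq> ball p e \<and>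
      continuous_on (closure B) G \<and> (\<forall>z\<in>closure B. G z \<noteq> 0) \<and>
      (\<forall>z\<in>frontier B. V z = G z * (z - p) powi k))"

text \<open>A zero-free factor does not change the index. This carries the data at the remaining
  zeros through the removal of another one, where the factor is a power of z - p.\<close>

lemma fillable_mult:
  assumes "fillable V p k" "0 < d" "continuous_on (ball p d) M" "\<And>z. z \<in> ball p d \<Longrightarrow> M z \<noteq> 0"
    "\<And>z. z \<in> ball p d \<Longrightarrow> W z = V z * M z"
  shows "fillable W p k"
  unfolding fillable_def
proof (intro allI impI)
  fix e :: real assume "0 < e"
  then obtain B G where B: "open B" "p \<in> B" "closure B \<subseteq> ball p (min d e)"
      "continuous_on (closure B) G" "\<forall>z\<in>closure B. G z \<noteq> 0"
      "\<forall>z\<in>frontier B. V z = G z * (z - p) powi k"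
    using assms(1)[unfolded fillable_def, rule_format, of "min d e"] assms(2) by auto
  have sub: "closure B \<subseteq> ball p d" "closure B \<subseteq> ball p e" "frontier B \<subseteq> closure B"
    using B(3) by (auto simp: frontier_def)
  show "\<exists>B G. open B \<and> p \<in> B \<and> closure B \<subseteq> ball p e \<and>
      continuous_on (closure B) G \<and> (\<forall>z\<in>closure B. G z \<noteq> 0) \<and>
      (\<forall>z\<in>frontier B. W z = G z * (z - p) powi k)"
  proof (intro exI[of _ B] exI[of _ "\<lambda>z. G z * M z"] conjI ballI)
    show "continuous_on (closure B) (\<lambda>z. G z * M z)"
      using B(4) continuous_on_subset[OF assms(3) sub(1)] by (intro continuous_intros)
    show "G z * M z \<noteq> 0" if "z \<in> closure B" for z using that B(5) assms(4) sub(1) by auto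
    show "W z = G z * M z * (z - p) powi k" if "z \<in> frontier B" for z
      using that B(6) assms(5)[of z] sub by auto
  qed (use B sub in auto)
qed

text \<open>Induction over the zeros: dividing by \<open>(z - p) powi k p\<close> away from p and
  inserting the filling near p yields a field with one zero fewer. The divided factor contributes
  \<open>k p\<close> times the winding number of the curve about p. The field must vary in the
  induction.\<close>

lemma winding_number_eq_sum_indices:
  assumes "finite Z" "compact D" "connected (- D)"
    and "path g" "pathfinish g = pathstart g" "path_image g \<subseteq> D" "path_image g \<inter> Z = {}"
    and "continuous_on D V" "\<And>z. z \<in> D \<Longrightarrow> z \<notin> Z \<Longrightarrow> V z \<noteq> 0" "Z \<subseteq> interior D"
    and "\<And>p. p \<in> Z \<Longrightarrow> fillable V p (k p)"
  shows "winding_number (V \<circ> g) 0 = (\<Sum>p\<in>Z. of_int (k p) * winding_number g p)"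
  using assms
proof (induction Z arbitrary: V rule: finite_induct)
  case empty
  \<comment> \<open>Borsuk's criterion: on a compact plane set with connected complement every
    zero-free continuous function has a continuous logarithm.\<close>
  have "Borsukian D" using empty Borsukian_separation_compact by blast
  then obtain L where L: "continuous_on D L" "\<And>x. x \<in> D \<Longrightarrow> V x = exp (L x)"
    unfolding Borsukian_continuous_logarithm using empty by (metis ComplI Pi_I empty_iff singletonD)
  have "winding_number (V \<circ> g) 0 = 0"
  proof (rule winding_number_exp_lift_loop)
    show "continuous_on {0..1} (L \<circ> g)"
      using empty L(1) by (intro continuous_on_compose) (auto simp: path_def path_image_def intro: continuous_on_subset)
    show "(V \<circ> g) t = exp ((L \<circ> g) t)" if "t \<in> {0..1}" for t
      using that L(2) empty(5) by (auto simp: path_image_def image_subset_iff)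
    show "(L \<circ> g) 0 = (L \<circ> g) 1"
      using empty by (simp add: pathfinish_def pathstart_def)
  qed
  then show ?case by (simp only: sum.empty)
next
  case (insert p Z)
  have pD: "p \<in> interior D" and pZ: "p \<notin> Z" using insert by auto
  have "closed (Z \<union> path_image g)"
    using insert by (simp add: closed_Un closed_path_image finite_imp_closed)
  moreover have "p \<notin> Z \<union> path_image g" using insert by auto
  ultimately obtain e1 where e1: "0 < e1" "ball p e1 \<inter> (Z \<union> path_image g) = {}"
    by (metis (no_types, lifting) Compl_iff disjoint_eq_subset_Compl open_Compl open_contains_ball)
  obtain e2 where e2: "0 < e2" "ball p e2 \<subseteq> D" using pD mem_interior by blast
  obtain B G where B: "open B" "p \<in> B" "closure B \<subseteq> ball p (min e1 e2)"
      "continuous_on (closure B) G" "\<And>z. z\<in>closure B \<Longrightarrow> G z \<noteq> 0"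
      "\<And>z. z\<in>frontier B \<Longrightarrow> V z = G z * (z - p) powi k p"
    using insert(13)[of p] e1(1) e2(1) unfolding fillable_def
    by (metis insertI1 min_less_iff_conj)
  have "ball p (min e1 e2) \<subseteq> ball p e1" by (simp add: subset_ball)
  then have disj: "closure B \<inter> (Z \<union> path_image g) = {}" using B(3) e1(2) by blast
  \<comment> \<open>Surgery at p. The neighbourhood avoids the curve and the other zeros, so the new
    field differs from V along the curve only by the power of z - p.\<close>
  define W where "W = (\<lambda>z. if z \<in> closure B then G z else V z * (z - p) powi (- k p))"
  have "ball p (min e1 e2) \<subseteq> D" using e2(2) by (meson ball_trivial min.cobounded2 order_trans subset_ball)
  then have BD: "closure B \<subseteq> D" "B \<subseteq> closure B" using B(3) closure_subset[of B] by auto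
  have "continuous_on (closure B \<union> (D - B)) W"
    unfolding W_def
  proof (rule continuous_on_cases)
    show "closed (D - B)" using B(1) insert by (simp add: closed_Diff compact_imp_closed)
    show "continuous_on (D - B) (\<lambda>z. V z * (z - p) powi (- k p))"
      using insert B(2) by (auto intro!: continuous_intros intro: continuous_on_subset)
    show "\<forall>z. z \<in> closure B \<and> z \<notin> closure B \<or> z \<in> D - B \<and> z \<in> closure B
        \<longrightarrow> G z = V z * (z - p) powi (- k p)"
    proof (intro allI impI)
      fix z assume "z \<in> closure B \<and> z \<notin> closure B \<or> z \<in> D - B \<and> z \<in> closure B"
      \<comment> \<open>Since B is open, the two pieces meet only in its frontier, exactly where the
        filling is tied to V.\<close>
      then have z: "z \<in> frontier B" "z \<noteq> p" using B(1,2) by (auto simp: frontier_def interior_open)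
      then show "G z = V z * (z - p) powi (- k p)" using B(6)[OF z(1)] by (simp add: power_int_minus)
    qed
  qed (use B in auto)
  moreover have "closure B \<union> (D - B) = D" using BD by auto
  ultimately have Wc: "continuous_on D W" by simp
  have W0: "W z \<noteq> 0" if "z \<in> D" "z \<notin> Z" for z
  proof (cases "z \<in> closure B")
    case True then show ?thesis using B(5) by (simp add: W_def)
  next
    case False
    then have "z \<noteq> p" using B(2) BD by auto
    then show ?thesis using False that insert(11)[of z] by (simp add: W_def)
  qed
  have Wf: "fillable W q (k q)" if q: "q \<in> Z" for q
  proof -
    have "q \<notin> closure B" using disj q by auto
    then obtain d where d: "0 < d" "ball q d \<subseteq> - closure B"
      using open_contains_ball[of "- closure B"] by auto
    have np: "z \<noteq> p" if "z \<in> ball q d" for z using that d(2) B(2) BD by blast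
    show ?thesis
    proof (rule fillable_mult[OF _ d(1)])
      show "fillable V q (k q)" using insert(13) q by blast
      show "continuous_on (ball q d) (\<lambda>z. (z - p) powi (- k p))" 
        using np by (intro continuous_intros) auto
      show "(z - p) powi (- k p) \<noteq> 0" if "z \<in> ball q d" for z using np[OF that] by simp
      show "W z = V z * (z - p) powi (- k p)" if "z \<in> ball q d" for z
        using that d(2) unfolding W_def by auto
    qed
  qed
  have IH: "winding_number (W \<circ> g) 0 = (\<Sum>p\<in>Z. of_int (k p) * winding_number g p)"
    by (rule insert.IH) (use insert Wc W0 Wf in auto)
  have cg: "continuous_on {0..1} g" using insert by (simp add: path_def)
  have gp: "g t \<noteq> p" "g t \<in> D" "g t \<notin> Z" "g t \<notin> closure B" if "t \<in> {0..1}" for t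
  proof -
    have "g t \<in> path_image g" using that by (auto simp: path_image_def)
    then show "g t \<noteq> p" "g t \<in> D" "g t \<notin> Z" "g t \<notin> closure B"
      using insert disj by auto
  qed
  have "winding_number (V \<circ> g) 0 = winding_number (\<lambda>t. (W \<circ> g) t * (g t - p) powi k p) 0"
  proof (rule winding_number_cong)
    fix t :: real assume "0 \<le> t" "t \<le> 1"
    then have t: "t \<in> {0..1}" by simp
    show "(V \<circ> g) t = (W \<circ> g) t * (g t - p) powi k p"
      using gp[OF t] by (simp add: W_def power_int_minus)
  qed
  also have "\<dots> = winding_number (W \<circ> g) 0 + winding_number (\<lambda>t. (g t - p) powi k p) 0"
  proof (rule winding_number_mult)
    show "continuous_on {0..1} (W \<circ> g)"
      by (intro continuous_on_compose cg continuous_on_subset[OF Wc]) (use gp in auto)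
    show "continuous_on {0..1} (\<lambda>t. (g t - p) powi k p)"
      using gp by (intro continuous_intros cg) auto
  qed (use gp W0 in auto)
  also have "winding_number (\<lambda>t. (g t - p) powi k p) 0 = of_int (k p) * winding_number (\<lambda>t. g t - p) 0"
    using gp by (intro winding_number_powi continuous_intros cg) auto
  also have "winding_number (\<lambda>t. g t - p) 0 = winding_number g p"
    by (rule winding_number_offset[symmetric])
  finally show ?case unfolding IH sum.insert[OF insert(1,2)] by (simp only: add.commute)
qed

text \<open>Winding number zero means null-homotopic in the punctured plane, and a null-homotopic
  map of a sphere extends over the ball within the same target.\<close>

lemma circle_map_extension:
  assumes "0 < r" "continuous_on (sphere a r) f" "\<And>z. z \<in> sphere a r \<Longrightarrow> f z \<noteq> 0"
    "winding_number (\<lambda>t. f (a + of_real r * exp (2 * pi * \<i> * of_real t))) 0 = 0"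
  obtains g where "continuous_on (cball a r) g" "\<And>z. z \<in> cball a r \<Longrightarrow> g z \<noteq> 0"
    "\<And>z. z \<in> sphere a r \<Longrightarrow> g z = f z"
proof -
  define p where "p = (\<lambda>t::real. f (a + of_real r * exp (2 * pi * \<i> * of_real t)))"
  have on: "a + of_real r * exp (2 * pi * \<i> * of_real t) \<in> sphere a r" for t
    using assms(1) by (simp add: dist_norm norm_mult)
  have pp: "path p" unfolding p_def path_def
    by (rule continuous_on_compose2[OF assms(2)]) (use on in \<open>auto intro!: continuous_intros\<close>)
  moreover have "0 \<notin> path_image p" using assms(3) on by (force simp: p_def path_image_def)
  ultimately obtain c where "homotopic_loops (- {0}) p (\<lambda>t. c)"
    using winding_number_homotopic_loops_null_eq[of p 0] assms(4) unfolding p_def by auto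
  \<comment> \<open>The loop becomes a map on the unit circle by reading
    \<open>Arg2pi z / (2 * pi)\<close> as the path parameter.\<close>
  from homotopic_loops_imp_homotopic_circlemaps[OF this]
  have "homotopic_with_canon (\<lambda>h. True) (sphere 0 1) (- {0})
      (\<lambda>z. p (Arg2pi z / (2 * pi))) (\<lambda>z. c)" by (simp add: o_def)
  then obtain G where G: "continuous_on (cball 0 1) G" "G ` cball 0 1 \<subseteq> - {0}"
      "\<And>z. z \<in> sphere 0 1 \<Longrightarrow> G z = p (Arg2pi z / (2 * pi))"
    using nullhomotopic_from_sphere_extension[of "0::complex" 1 "- {0::complex}" "\<lambda>z. p (Arg2pi z / (2 * pi))"]
    by blast
  have in_cball: "(z - a) / of_real r \<in> cball 0 1" if "z \<in> cball a r" for z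
    using that assms(1) by (simp add: dist_norm norm_divide norm_minus_commute)
  show ?thesis
  proof
    show "continuous_on (cball a r) (\<lambda>z. G ((z - a) / of_real r))"
      by (rule continuous_on_compose2[OF G(1)]) (use in_cball assms(1) in \<open>auto intro!: continuous_intros\<close>)
    show "G ((z - a) / of_real r) \<noteq> 0" if "z \<in> cball a r" for z
      using G(2) in_cball[OF that] by blast
    show "G ((z - a) / of_real r) = f z" if z: "z \<in> sphere a r" for z
    proof -
      let ?w = "(z - a) / of_real r"
      have n: "norm ?w = 1" using z assms(1) by (simp add: dist_norm norm_divide norm_minus_commute)
      have "?w = of_real (norm ?w) * exp (\<i> * of_real (Arg2pi ?w))" by (rule Arg2pi_eq)
      then have "exp (\<i> * of_real (Arg2pi ?w)) = ?w" using n by simp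
      then have "a + of_real r * exp (\<i> * of_real (Arg2pi ?w)) = z" using assms(1) by simp
      moreover have "2 * pi * \<i> * of_real (Arg2pi ?w / (2 * pi)) = \<i> * of_real (Arg2pi ?w)"
        by simp
      ultimately have "p (Arg2pi ?w / (2 * pi)) = f z" unfolding p_def by metis
      then show ?thesis using G(3)[of ?w] n by simp
    qed
  qed
qed

section \<open>The index in a chart\<close>

definition circle :: "complex \<Rightarrow> real \<Rightarrow> real \<Rightarrow> complex" where
  "circle a r t = a + of_real r * exp (2 * pi * \<i> * of_real t)"

lemma circle_props:
  "dist a (circle a r t) = \<bar>r\<bar>" "circle a r 0 = circle a r 1" "continuous_on S (circle a r)"
  by (auto simp: circle_def dist_norm norm_mult exp_two_pi_i' exp_two_pi_i 
      intro!: continuous_intros)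

lemma winding_number_circle:
  assumes "0 < r"
  shows "winding_number (\<lambda>t. circle a r t - a) 0 = 1"
proof -
  have "winding_number (\<lambda>t. circle a r t - a) 0
    = ((of_real (ln r) + 2 * pi * \<i> * of_real 1) - (of_real (ln r) + 2 * pi * \<i> * of_real 0)) / (2 * of_real pi * \<i>)"
    by (rule winding_number_exp_lift)
      (use assms in \<open>auto simp: circle_def exp_add exp_of_real intro!: continuous_intros\<close>)
  then show ?thesis by simp
qed

text \<open>A quantitative form of "orientation-preserving local diffeomorphism": up to a
  perturbation with Lipschitz constant B smaller than \<open>norm A\<close>, w is the complex-linear
  map with factor A. Injectivity, a Lipschitz inverse and the sense of rotation all follow from this
  one inequality.\<close>

locale local_chart =
  fixes w :: "complex \<Rightarrow> complex" and p A :: complex and B e0 :: real and V :: "complex \<Rightarrow> complex"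
  assumes e0: "0 < e0" and B: "B < norm A"
    and near: "\<And>z z'. z \<in> ball p e0 \<Longrightarrow> z' \<in> ball p e0 \<Longrightarrow> norm (w z - w z' - A * (z - z')) \<le> B * norm (z - z')"
    and V: "continuous_on (ball p e0) V" "\<And>z. z \<in> ball p e0 \<Longrightarrow> z \<noteq> p \<Longrightarrow> V z \<noteq> 0"
begin

definition "h = inv_into (ball p e0) w"

lemma norm_diff_le: 
  assumes "z \<in> ball p e0" "z' \<in> ball p e0"
  shows "norm (z - z') \<le> norm (w z - w z') / (norm A - B)"
proof -
  have "norm A * norm (z - z') \<le> norm (w z - w z') + norm (w z - w z' - A * (z - z'))"
    unfolding norm_mult[symmetric] by norm
  also have "\<dots> \<le> norm (w z - w z') + B * norm (z - z')" using near[OF assms] by simp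
  finally have "norm (z - z') * (norm A - B) \<le> norm (w z - w z')"
    by (simp add: right_diff_distrib mult.commute[of "norm (z - z')"])
  then show ?thesis using B by (simp add: pos_le_divide_eq)
qed

lemma inj: "inj_on w (ball p e0)"
proof (rule inj_onI)
  fix z z' assume "z \<in> ball p e0" "z' \<in> ball p e0" "w z = w z'"
  then show "z = z'" using norm_diff_le[of z z'] by simp
qed

lemma cont_w: "continuous_on (ball p e0) w"
  unfolding continuous_on_iff
proof (intro ballI allI impI)
  fix z e :: "complex" and e' :: real assume z: "z \<in> ball p e0" and e': "0 < e'"
  define C where "C = norm A + \<bar>B\<bar> + 1"
  have C: "0 < C" unfolding C_def by (smt (verit) norm_ge_zero)
  show "\<exists>d>0. \<forall>x'\<in>ball p e0. dist x' z < d \<longrightarrow> dist (w x') (w z) < e'"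
  proof (intro exI[of _ "e' / C"] conjI ballI impI)
    fix x' assume x': "x' \<in> ball p e0" "dist x' z < e' / C"
    have "norm (w x' - w z) \<le> norm (A * (x' - z)) + norm (w x' - w z - A * (x' - z))" by norm
    also have "\<dots> \<le> norm A * norm (x' - z) + B * norm (x' - z)"
      using near[OF x'(1) z] by (simp add: norm_mult)
    also have "\<dots> \<le> C * norm (x' - z)"
      unfolding C_def distrib_right[symmetric] by (rule mult_right_mono) auto
    also have "\<dots> < e'" using x'(2) C by (simp add: dist_norm field_simps)
    finally show "dist (w x') (w z) < e'" by (simp add: dist_norm)
  qed (use e' C in auto)
qed

lemma open_image: "open (w ` ball p e0)"
  by (rule invariance_of_domain[OF cont_w open_ball inj])

lemma h_w: "z \<in> ball p e0 \<Longrightarrow> h (w z) = z"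
  unfolding h_def using inj by simp

lemma w_h: "a \<in> w ` ball p e0 \<Longrightarrow> w (h a) = a" "a \<in> w ` ball p e0 \<Longrightarrow> h a \<in> ball p e0"
  unfolding h_def by (rule f_inv_into_f, assumption) (rule inv_into_into, assumption)

lemma cont_h: "continuous_on (w ` ball p e0) h"
  unfolding continuous_on_iff
proof (intro ballI allI impI)
  fix a and e :: real assume a: "a \<in> w ` ball p e0" and e: "0 < e"
  show "\<exists>d>0. \<forall>x'\<in>w ` ball p e0. dist x' a < d \<longrightarrow> dist (h x') (h a) < e"
  proof (intro exI[of _ "e * (norm A - B)"] conjI ballI impI)
    fix x' assume x': "x' \<in> w ` ball p e0" "dist x' a < e * (norm A - B)"
    show "dist (h x') (h a) < e"
      using norm_diff_le[OF w_h(2)[OF x'(1)] w_h(2)[OF a]] x' a B w_h(1)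
      by (smt (verit) dist_norm divide_less_eq)
  qed (use e B in auto)
qed

text \<open>Independence of the radius: a logarithm on the rectangle of radii and angles has an
  increment over one full turn that depends continuously on the radius. Its exponential is 1 because
  the circles close up, so the increment is constant.\<close>

lemma exists_index:
  "\<exists>R k. 0 < R \<and> cball (w p) R \<subseteq> w ` ball p e0 \<and> (\<forall>r. 0 < r \<and> r \<le> R \<longrightarrow>
     winding_number (\<lambda>t. V (h (circle (w p) r t))) 0 = of_int k)"
proof -
  have "w p \<in> w ` ball p e0" using e0 by auto
  then obtain R where R: "0 < R" "cball (w p) R \<subseteq> w ` ball p e0"
    using open_image open_contains_cball by blast
  have hR: "a \<in> w ` ball p e0" "h a \<in> ball p e0" if "a \<in> cball (w p) R" for a
    using R(2) that w_h by blast+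
  have nz: "V (h a) \<noteq> 0" if "a \<in> cball (w p) R" "a \<noteq> w p" for a
  proof -
    have "a \<in> w ` ball p e0" using R(2) that(1) by blast
    then have "h a \<in> ball p e0" "h a \<noteq> p" using w_h[of a] that(2) by auto
    then show ?thesis by (rule V(2))
  qed
  let ?W = "\<lambda>r. winding_number (\<lambda>t. V (h (circle (w p) r t))) 0"
  have "?W R \<in> \<int>"
  proof (rule integer_winding_number)
    have cin: "circle (w p) R t \<in> cball (w p) R" "circle (w p) R t \<noteq> w p" for t
      using R(1) circle_props(1)[of "w p" R t] by auto
    show "path (\<lambda>t. V (h (circle (w p) R t)))"
      unfolding path_def
    proof (rule continuous_on_compose2[OF V(1)], rule continuous_on_compose2[OF cont_h])
      show "continuous_on {0..1} (circle (w p) R)" by (rule circle_props)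
    qed (use cin hR in blast)+
    show "0 \<notin> path_image (\<lambda>t. V (h (circle (w p) R t)))"
      using nz cin by (auto simp: path_image_def)
  qed (auto simp: pathfinish_def pathstart_def circle_props)
  then obtain k where k: "?W R = of_int k" by (auto elim: Ints_cases)
  have "?W r = ?W R" if r: "0 < r" "r \<le> R" for r
  proof -
    let ?S = "{r..R} \<times> {0..1::real}"
    let ?f = "\<lambda>x. V (h (circle (w p) (fst x) (snd x)))"
    have cin: "circle (w p) (fst x) (snd x) \<in> cball (w p) R" "circle (w p) (fst x) (snd x) \<noteq> w p" if "x \<in> ?S" for x
      using r that circle_props(1)[of "w p" "fst x" "snd x"] by auto
    have "continuous_on ?S ?f"
    proof (rule continuous_on_compose2[OF V(1)], rule continuous_on_compose2[OF cont_h])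
      show "continuous_on ?S (\<lambda>x. circle (w p) (fst x) (snd x))"
        unfolding circle_def by (intro continuous_intros)
    qed (use cin hR in blast)+
    moreover have "contractible ?S"
      by (intro convex_imp_contractible convex_Times) auto
    moreover have "?f x \<noteq> 0" if "x \<in> ?S" for x using nz cin[OF that] by blast
    ultimately obtain L where L: "continuous_on ?S L" "\<And>x. x \<in> ?S \<Longrightarrow> ?f x = exp (L x)"
      using continuous_logarithm_on_contractible by blast
    have W: "?W \<rho> = (L (\<rho>, 1) - L (\<rho>, 0)) / (2 * of_real pi * \<i>)" if "\<rho> \<in> {r..R}" for \<rho>
    proof (rule winding_number_exp_lift)
      show "continuous_on {0..1} (\<lambda>t. L (\<rho>, t))"
        by (rule continuous_on_compose2[OF L(1)]) (use that in \<open>auto intro!: continuous_intros\<close>)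
      show "V (h (circle (w p) \<rho> t)) = exp (L (\<rho>, t))" if t: "t \<in> {0..1}" for t
        using L(2)[of "(\<rho>, t)"] that \<open>\<rho> \<in> {r..R}\<close> by auto
    qed
    have "L (r, 1) - L (r, 0) = L (R, 1) - L (R, 0)"
    proof (rule constant_of_exp_constant[of "{r..R}" "\<lambda>\<rho>. L (\<rho>, 1) - L (\<rho>, 0)" 1])
      show "continuous_on {r..R} (\<lambda>\<rho>. L (\<rho>, 1) - L (\<rho>, 0))"
        by (intro continuous_intros; rule continuous_on_compose2[OF L(1)]) (auto intro!: continuous_intros)
      show "exp (L (\<rho>, 1) - L (\<rho>, 0)) = 1" if "\<rho> \<in> {r..R}" for \<rho>
        using L(2)[of "(\<rho>, 0)"] L(2)[of "(\<rho>, 1)"] that circle_props(2)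
        by (auto simp: exp_diff)
    qed (use r in auto)
    then show ?thesis using W[of r] W[of R] r by simp
  qed
  then show ?thesis using R k by (intro exI[of _ R] exI[of _ k]) auto
qed

definition "radius = (SOME R. 0 < R \<and> cball (w p) R \<subseteq> w ` ball p e0 \<and> (\<exists>k::int. \<forall>r. 0 < r \<and> r \<le> R \<longrightarrow>
     winding_number (\<lambda>t. V (h (circle (w p) r t))) 0 = of_int k))"
definition "index = (SOME k::int. \<forall>r. 0 < r \<and> r \<le> radius \<longrightarrow>
     winding_number (\<lambda>t. V (h (circle (w p) r t))) 0 = of_int k)"

lemma radius: "0 < radius" "cball (w p) radius \<subseteq> w ` ball p e0"
  and index: "0 < r \<Longrightarrow> r \<le> radius \<Longrightarrow> winding_number (\<lambda>t. V (h (circle (w p) r t))) 0 = of_int index"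
proof -
  have *: "0 < radius \<and> cball (w p) radius \<subseteq> w ` ball p e0 \<and> (\<exists>k::int. \<forall>r. 0 < r \<and> r \<le> radius \<longrightarrow>
     winding_number (\<lambda>t. V (h (circle (w p) r t))) 0 = of_int k)"
    unfolding radius_def by (rule someI_ex) (use exists_index in blast)
  then show "0 < radius" "cball (w p) radius \<subseteq> w ` ball p e0" by auto
  show "0 < r \<Longrightarrow> r \<le> radius \<Longrightarrow> winding_number (\<lambda>t. V (h (circle (w p) r t))) 0 = of_int index"
    using someI_ex[OF conjunct2[OF conjunct2[OF *]]] unfolding index_def by blast
qed

lemma h_small:
  assumes "0 < e"
  obtains r where "0 < r" "r < e" "r < radius" "h ` cball (w p) r \<subseteq> ball p e"
proof
  \<comment> \<open>The inverse h has Lipschitz constant \<open>1 / (norm A - B)\<close>; the third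
    bound therefore keeps the image within e / 2 of p.\<close>
  define r where "r = min (min (e / 2) (radius / 2)) (e * (norm A - B) / 2)"
  show r: "0 < r" using assms radius B by (simp add: r_def)
  show "r < e" "r < radius" using assms radius by (auto simp: r_def)
  show "h ` cball (w p) r \<subseteq> ball p e"
  proof
    fix z assume "z \<in> h ` cball (w p) r"
    then obtain a where a: "z = h a" "a \<in> cball (w p) r" by blast
    have "a \<in> w ` ball p e0" using a radius \<open>r < radius\<close> by (meson mem_cball order.trans less_imp_le subsetD)
    then have "norm (p - z) \<le> norm (w p - a) / (norm A - B)"
      using norm_diff_le[of p z] w_h[of a] a e0 by simp
    also have "\<dots> \<le> r / (norm A - B)"
      using a B by (intro divide_right_mono) (auto simp: dist_norm)
    also have "\<dots> \<le> (e * (norm A - B) / 2) / (norm A - B)" using B by (intro divide_right_mono) (auto simp: r_def)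
    also have "\<dots> = e / 2" using B by (simp add: field_simps)
    also have "\<dots> < e" using assms by simp
    finally show "z \<in> ball p e" by (simp add: dist_norm)
  qed
qed

lemma circle_in:
  assumes "0 < r" "r \<le> radius"
  shows "circle (w p) r t \<in> w ` ball p e0" "h (circle (w p) r t) \<in> ball p e0" "h (circle (w p) r t) \<noteq> p"
    "w (h (circle (w p) r t)) = circle (w p) r t"
proof -
  have "circle (w p) r t \<in> cball (w p) radius" "circle (w p) r t \<noteq> w p"
    using assms circle_props(1)[of "w p" r t] by auto
  then show "circle (w p) r t \<in> w ` ball p e0" "h (circle (w p) r t) \<in> ball p e0" "h (circle (w p) r t) \<noteq> p"
    "w (h (circle (w p) r t)) = circle (w p) r t"
    using radius(2) w_h[of "circle (w p) r t"] by auto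
qed

lemma cont_h_circle:
  assumes "0 < r" "r \<le> radius"
  shows "continuous_on {0..1} (\<lambda>t. h (circle (w p) r t))"
  by (rule continuous_on_compose2[OF cont_h circle_props(3)]) (use circle_in[OF assms] in auto)

text \<open>Here the chart's orientation enters. On the pulled-back circle w - w p differs from
  \<open>A * (z - p)\<close> by less than the norm of the latter, so both wind equally often, and
  the constant A adds nothing.\<close>

lemma winding_number_h_circle:
  assumes "0 < r" "r \<le> radius"
  shows "winding_number (\<lambda>t. h (circle (w p) r t) - p) 0 = 1"
proof -
  let ?c = "\<lambda>t. h (circle (w p) r t)"
  note ci = circle_in[OF assms]
  have A: "A \<noteq> 0" using B near[of p p] e0
  proof -
    obtain z where z: "z \<in> ball p e0" "z \<noteq> p"
      using ci by blast
    have "0 \<le> B * norm (z - p)" using near[of z p] z e0 by (smt (verit) centre_in_ball norm_ge_zero)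
    then have "0 \<le> B" using z by (simp add: zero_le_mult_iff)
    then show ?thesis using B by auto
  qed
  have "1 = winding_number (\<lambda>t. circle (w p) r t - w p) 0" by (simp add: winding_number_circle assms)
  also have "\<dots> = winding_number (\<lambda>t. A * (?c t - p)) 0"
  proof (rule winding_number_near_one)
    show "continuous_on {0..1} (\<lambda>t. circle (w p) r t - w p)" by (intro continuous_intros circle_props)
    show "continuous_on {0..1} (\<lambda>t. A * (?c t - p))" by (intro continuous_intros cont_h_circle assms)
    show "A * (?c t - p) \<noteq> 0" for t using A ci by simp
    show "norm (circle (w p) r t - w p - A * (?c t - p)) < norm (A * (?c t - p))" for t
    proof -
      have "norm (circle (w p) r t - w p - A * (?c t - p)) \<le> B * norm (?c t - p)"
        using near[of "?c t" p] ci e0 by simp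
      also have "\<dots> < norm A * norm (?c t - p)" using ci B by simp
      finally show ?thesis by (simp add: norm_mult)
    qed
  qed (simp_all add: circle_props(2))
  also have "\<dots> = winding_number (\<lambda>t. A) 0 + winding_number (\<lambda>t. ?c t - p) 0"
    by (rule winding_number_mult) (use A ci in \<open>auto intro!: continuous_intros cont_h_circle assms\<close>)
  also have "winding_number (\<lambda>t. A) 0 = 0" using A by (intro winding_number_zero_const) auto
  finally show ?thesis by simp
qed

text \<open>Along the pulled-back circle the field winds \<open>index\<close> times and z - p winds
  once. The quotient by the matching power thus has winding number zero and extends over the disc in
  the w-plane; composing the extension with w gives the filling.\<close>

lemma fillable_index: "fillable V p index"
  unfolding fillable_def
proof (intro allI impI)
  fix e :: real assume "0 < e"
  then obtain r where r: "0 < r" "r < radius" "h ` cball (w p) r \<subseteq> ball p e" by (rule h_small)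
  then have r': "r \<le> radius" by simp
  have sub: "cball (w p) r \<subseteq> w ` ball p e0" using subset_cball[OF r'] radius(2) by (rule order_trans)
  define \<Phi> where "\<Phi> = (\<lambda>a. V (h a) * (h a - p) powi (- index))"
  have ssub: "sphere (w p) r \<subseteq> w ` ball p e0" using sphere_cball sub by (rule order_trans)
  have hn: "h a \<noteq> p" "h a \<in> ball p e0" if "a \<in> sphere (w p) r" for a
  proof -
    have "a \<in> w ` ball p e0" "a \<noteq> w p" using that ssub r by auto
    then show "h a \<noteq> p" "h a \<in> ball p e0" using w_h[of a] by auto
  qed
  have ch: "continuous_on (sphere (w p) r) h" using cont_h ssub by (rule continuous_on_subset)
  note ci = circle_in[OF r(1) r']
  have "winding_number (\<lambda>t. \<Phi> (circle (w p) r t)) 0 = 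
    winding_number (\<lambda>t. V (h (circle (w p) r t))) 0 + winding_number (\<lambda>t. (h (circle (w p) r t) - p) powi (- index)) 0"
    unfolding \<Phi>_def
  proof (rule winding_number_mult)
    show "continuous_on {0..1} (\<lambda>t. V (h (circle (w p) r t)))"
      by (rule continuous_on_compose2[OF V(1) cont_h_circle]) (use circle_in(2) r r' in blast)+
    show "continuous_on {0..1} (\<lambda>t. (h (circle (w p) r t) - p) powi (- index))"
      by (rule continuous_on_power_int, intro continuous_intros cont_h_circle r(1) r') (use ci(3) in simp)
  qed (use ci(2,3) V(2) in simp_all)
  also have "winding_number (\<lambda>t. (h (circle (w p) r t) - p) powi (- index)) 0
      = of_int (- index) * winding_number (\<lambda>t. h (circle (w p) r t) - p) 0"
    by (rule winding_number_powi, intro continuous_intros cont_h_circle r(1) r') (use ci(3) in simp)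
  finally have wn: "winding_number (\<lambda>t. \<Phi> (circle (w p) r t)) 0 = 0"
    using winding_number_h_circle[OF r(1) r'] index[OF r(1) r'] by simp
  have "continuous_on (sphere (w p) r) (\<lambda>a. V (h a))"
    by (rule continuous_on_compose2[OF V(1) ch]) (use hn(2) in blast)
  moreover have "continuous_on (sphere (w p) r) (\<lambda>a. (h a - p) powi (- index))"
    by (rule continuous_on_power_int, intro continuous_intros ch) (use hn(1) in simp)
  ultimately have c\<Phi>: "continuous_on (sphere (w p) r) \<Phi>"
    unfolding \<Phi>_def by (rule continuous_on_mult)
  have n\<Phi>: "\<Phi> z \<noteq> 0" if "z \<in> sphere (w p) r" for z
    unfolding \<Phi>_def using hn[OF that] V(2)[of "h z"] by simp
  obtain \<Psi> where \<Psi>: "continuous_on (cball (w p) r) \<Psi>" "\<And>z. z \<in> cball (w p) r \<Longrightarrow> \<Psi> z \<noteq> 0"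
    "\<And>z. z \<in> sphere (w p) r \<Longrightarrow> \<Psi> z = \<Phi> z"
    using circle_map_extension[OF r(1) c\<Phi> n\<Phi> wn[unfolded circle_def]] by metis
  \<comment> \<open>The closure of U lies in the compact set K, which lies inside the chart;
    frontier points of U are therefore mapped by w exactly onto the bounding circle.\<close>
  define U where "U = ball p e0 \<inter> w -` ball (w p) r"
  define K where "K = h ` cball (w p) r"
  have "compact K" unfolding K_def
    by (intro compact_continuous_image continuous_on_subset[OF cont_h sub]) auto
  have "open U" unfolding U_def
    by (rule continuous_open_preimage[OF cont_w]) auto
  have "U \<subseteq> K"
  proof
    fix z assume "z \<in> U"
    then have "z = h (w z)" "w z \<in> cball (w p) r" by (auto simp: U_def h_w)
    then show "z \<in> K" unfolding K_def by blast
  qed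
  then have cU: "closure U \<subseteq> K" by (simp add: \<open>compact K\<close> closure_minimal compact_imp_closed)
  have Kw: "w z \<in> cball (w p) r" "z \<in> ball p e0" "h (w z) = z" if zK: "z \<in> K" for z
  proof -
    obtain a where a: "z = h a" "a \<in> cball (w p) r" using zK unfolding K_def by (rule imageE)
    then have "w z = a" "z \<in> ball p e0" using sub w_h by blast+
    then show "w z \<in> cball (w p) r" "z \<in> ball p e0" "h (w z) = z" using a by auto
  qed
  show "\<exists>B G. open B \<and> p \<in> B \<and> closure B \<subseteq> ball p e \<and>
      continuous_on (closure B) G \<and> (\<forall>z\<in>closure B. G z \<noteq> 0) \<and>
      (\<forall>z\<in>frontier B. V z = G z * (z - p) powi index)"
  proof (intro exI[of _ U] exI[of _ "\<lambda>z. \<Psi> (w z)"] conjI ballI)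
    show "p \<in> U" using e0 r by (simp add: U_def)
    show "closure U \<subseteq> ball p e" using cU r(3) unfolding K_def by blast
    show "continuous_on (closure U) (\<lambda>z. \<Psi> (w z))"
      by (rule continuous_on_compose2[OF \<Psi>(1) continuous_on_subset[OF cont_w]]) (use cU Kw in blast)+
    show "\<Psi> (w z) \<noteq> 0" if "z \<in> closure U" for z using that cU Kw \<Psi>(2) by blast
    show "V z = \<Psi> (w z) * (z - p) powi index" if "z \<in> frontier U" for z
    proof -
      have z: "z \<in> K" "z \<notin> U" using that cU \<open>open U\<close> by (auto simp: frontier_def interior_open)
      then have s: "w z \<in> sphere (w p) r" using Kw[OF z(1)] by (auto simp: U_def)
      have "z \<noteq> p" using hn(1)[OF s] Kw[OF z(1)] by simp
      then show ?thesis using \<Psi>(3)[OF s] Kw[OF z(1)] by (simp add: \<Phi>_def power_int_minus)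
    qed
  qed fact
qed

text \<open>This identifies the description in \<open>conf_index\<close>. Inside the injectivity
  ball a loop c with the prescribed w-image can only be h of the circle, so \<open>index\<close>
  qualifies; uniqueness needs such a loop to exist inside every ball about p.\<close>

lemma index_eq:
  "(THE k::int. \<exists>e>0. \<forall>r c. 0 < r \<and> r < e \<and> path c \<and> path_image c \<subseteq> ball p e \<and>
       (\<forall>t\<in>{0..1}. w (c t) = w p + of_real r * exp (2 * pi * \<i> * of_real t)) \<longrightarrow>
       winding_number (V \<circ> c) 0 = of_int k) = index" (is "(THE k. ?P k) = _")
proof (rule the_equality)
  show "?P index"
  \<comment> \<open>\<open>e0\<close> makes c determined by its image under w; \<open>radius\<close>
    makes the circle small enough for its winding number to be \<open>index\<close>.\<close>
  proof (intro exI[of _ "min e0 radius"] conjI allI impI)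
    show "0 < min e0 radius" using e0 radius by simp
    fix r c assume a: "0 < r \<and> r < min e0 radius \<and> path c \<and> path_image c \<subseteq> ball p (min e0 radius) \<and>
       (\<forall>t\<in>{0..1}. w (c t) = w p + of_real r * exp (2 * pi * \<i> * of_real t))"
    have "winding_number (V \<circ> c) 0 = winding_number (\<lambda>t. V (h (circle (w p) r t))) 0"
    proof (rule winding_number_cong)
      fix t :: real assume "0 \<le> t" "t \<le> 1"
      then have t: "t \<in> {0..1}" by simp
      then have "c t \<in> path_image c" by (auto simp: path_image_def)
      then have "c t \<in> ball p e0" using a by auto
      then have "c t = h (circle (w p) r t)" using h_w a t unfolding circle_def by metis
      then show "(V \<circ> c) t = V (h (circle (w p) r t))" by simp
    qed
    also have "\<dots> = of_int index" using a by (intro index) auto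
    finally show "winding_number (V \<circ> c) 0 = of_int index" .
  qed
next
  fix k assume "?P k"
  then obtain e where e: "0 < e" "\<And>r c. 0 < r \<Longrightarrow> r < e \<Longrightarrow> path c \<Longrightarrow> path_image c \<subseteq> ball p e \<Longrightarrow>
       (\<forall>t\<in>{0..1}. w (c t) = w p + of_real r * exp (2 * pi * \<i> * of_real t)) \<Longrightarrow>
       winding_number (V \<circ> c) 0 = of_int k" by metis
  obtain r where r: "0 < r" "r < e" "r < radius" "h ` cball (w p) r \<subseteq> ball p e" 
    by (rule h_small[OF e(1)])
  let ?c = "\<lambda>t. h (circle (w p) r t)"
  \<comment> \<open>The pulled-back circle is an admissible loop for the competing value k, so the
    condition on k is not vacuous.\<close>
  have "winding_number (V \<circ> ?c) 0 = of_int k"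
  proof (rule e(2)[OF r(1,2)])
    show "path ?c" unfolding path_def using cont_h_circle r by simp
    have "circle (w p) r t \<in> cball (w p) r" for t
      using r circle_props(1)[of "w p" r t] by auto
    then show "path_image ?c \<subseteq> ball p e" using r(4) by (auto simp: path_image_def)
    show "\<forall>t\<in>{0..1}. w (?c t) = w p + of_real r * exp (2 * pi * \<i> * of_real t)"
      using circle_in(4) r unfolding circle_def by simp
  qed
  then have "of_int k = (of_int index :: complex)" using index[of r] r by (simp add: o_def)
  then show "k = index" by (metis of_int_eq_iff)
qed

end

section \<open>Hopf's Umlaufsatz\<close>

lemma Ln_lift_upper_half_plane:
  fixes l :: "real \<Rightarrow> complex"
  assumes "continuous_on {0..1} l" "\<And>t. t \<in> {0..1} \<Longrightarrow> 0 \<le> Im (exp (l t))"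
    "exp (l 0) = of_real c" "exp (l 1) = - of_real c" "0 < c"
  shows "l 1 - l 0 = \<i> * pi"
proof -
  \<comment> \<open>Division by \<i> turns the closed upper half-plane without 0 into the closed
    right half-plane without 0, which avoids the cut of \<open>Ln\<close>.\<close>
  let ?m = "\<lambda>t. Ln (exp (l t) / \<i>)"
  have nr: "exp (l t) / \<i> \<notin> \<real>\<^sub>\<le>\<^sub>0" if "t \<in> {0..1}" for t
  proof
    assume "exp (l t) / \<i> \<in> \<real>\<^sub>\<le>\<^sub>0"
    then have "Im (exp (l t)) \<le> 0" "Re (exp (l t)) = 0"
      by (auto simp: complex_nonpos_Reals_iff)
    with assms(2)[OF that] have "exp (l t) = 0" by (simp add: complex_eq_iff)
    then show False by simp
  qed
  have "l 1 - ?m 1 = l 0 - ?m 0"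
  proof (rule constant_of_exp_constant[of "{0..1::real}" "\<lambda>t. l t - ?m t" \<i>])
    show "continuous_on {0..1} (\<lambda>t. l t - ?m t)"
      by (intro continuous_intros assms nr) auto
    show "exp (l t - ?m t) = \<i>" for t by (simp add: exp_diff)
  qed auto
  then have "l 1 - l 0 = Ln (- of_real c / \<i>) - Ln (of_real c / \<i>)"
    using assms(3,4) by (simp add: algebra_simps)
  also have "\<dots> = Ln (of_real c * \<i>) - Ln (of_real c * (- \<i>))" by (simp add: mult.commute)
  also have "\<dots> = \<i> * pi"
    unfolding Ln_times_of_real[OF assms(5) complex_i_not_zero]
      Ln_times_of_real[OF assms(5), of "- \<i>", simplified neg_equal_0_iff_equal, OF complex_i_not_zero] by simp
  finally show ?thesis .
qed

text \<open>The curve lives on the whole line with period 1, so derivatives at the base point are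
  two-sided and parameters may be shifted to t - 1 below zero.\<close>

locale regular_loop =
  fixes \<gamma> \<tau> :: "real \<Rightarrow> complex"
  assumes deriv: "\<And>t. (\<gamma> has_vector_derivative \<tau> t) (at t)"
    and cont_\<tau>: "continuous_on UNIV \<tau>"
    and \<tau>_nz: "\<And>t. \<tau> t \<noteq> 0"
    and period: "\<And>t. \<gamma> (t + 1) = \<gamma> t"
    and inj: "inj_on \<gamma> {0..<1}"
begin

lemma cont_\<gamma>: "continuous_on S \<gamma>"
  by (meson continuous_at_imp_continuous_on deriv has_vector_derivative_continuous)

lemma period_\<tau>: "\<tau> (t + 1) = \<tau> t"
proof -
  have "((\<gamma> \<circ> (\<lambda>t. t + 1)) has_vector_derivative 1 *\<^sub>R \<tau> (t + 1)) (at t)"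
    by (rule vector_diff_chain_at) (auto intro!: derivative_eq_intros deriv)
  then have "(\<gamma> has_vector_derivative \<tau> (t + 1)) (at t)" by (simp add: o_def period)
  then show ?thesis using deriv vector_derivative_at by metis
qed

lemma path: "path \<gamma>" and loop: "pathfinish \<gamma> = pathstart \<gamma>" and simple: "simple_path \<gamma>"
proof -
  show p: "path \<gamma>" unfolding path_def by (rule cont_\<gamma>)
  show "pathfinish \<gamma> = pathstart \<gamma>" using period[of 0] by (simp add: pathfinish_def pathstart_def)
  have "loop_free \<gamma>"
    unfolding loop_free_def
  proof (intro ballI impI)
    fix x y :: real assume xy: "x \<in> {0..1}" "y \<in> {0..1}" "\<gamma> x = \<gamma> y"
    define r where "r = (\<lambda>x::real. if x = 1 then 0 else x)"
    have "\<gamma> (r x) = \<gamma> x" for x using period[of 0] by (simp add: r_def)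
    moreover have "r x \<in> {0..<1}" if "x \<in> {0..1}" for x using that by (auto simp: r_def)
    ultimately have "r x = r y" using inj xy by (metis inj_onD)
    then show "x = y \<or> x = 0 \<and> y = 1 \<or> x = 1 \<and> y = 0" by (auto simp: r_def split: if_splits)
  qed
  then show "simple_path \<gamma>" using p by (simp add: simple_path_def)
qed

text \<open>The mean of the tangent over the parameters between s and t. It equals the difference
  quotient off the diagonal and is continuous across it, with value \<tau> there.\<close>

definition chord :: "real \<Rightarrow> real \<Rightarrow> complex" where
  "chord s t = integral (cbox 0 1) (\<lambda>u. \<tau> (s + u * (t - s)))"

lemma chord: "\<gamma> t - \<gamma> s = of_real (t - s) * chord s t"
proof -
  have "((\<lambda>u. (t - s) *\<^sub>R \<tau> (s + u * (t - s))) has_integral \<gamma> (s + 1 * (t - s)) - \<gamma> (s + 0 * (t - s))) {0..1}"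
  proof (rule fundamental_theorem_of_calculus)
    fix u :: real
    have "((\<gamma> \<circ> (\<lambda>u. s + u * (t - s))) has_vector_derivative (t - s) *\<^sub>R \<tau> (s + u * (t - s))) (at u)"
      by (rule vector_diff_chain_at) (auto intro!: derivative_eq_intros deriv)
    then show "((\<lambda>u. \<gamma> (s + u * (t - s))) has_vector_derivative (t - s) *\<^sub>R \<tau> (s + u * (t - s))) (at u within {0..1})"
      by (simp add: o_def has_vector_derivative_at_within)
  qed simp
  then have "\<gamma> t - \<gamma> s = integral {0..1} (\<lambda>u. (t - s) *\<^sub>R \<tau> (s + u * (t - s)))"
    by (intro integral_unique[symmetric]) simp
  also have "\<dots> = (t - s) *\<^sub>R integral {0..1} (\<lambda>u. \<tau> (s + u * (t - s)))" by (rule integral_cmul)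
  finally show ?thesis by (simp add: chord_def scaleR_conv_of_real)
qed

lemma chord_diag: "chord t t = \<tau> t"
  by (simp add: chord_def)

lemma cont_chord: "continuous_on S (\<lambda>x. chord (fst x) (snd x))"
  unfolding chord_def
proof (rule integral_continuous_on_param)
  have "continuous_on (S \<times> cbox 0 1) (\<lambda>x. \<tau> (fst (fst x) + snd x * (snd (fst x) - fst (fst x))))"
    by (rule continuous_on_compose2[OF cont_\<tau>]) (auto intro!: continuous_intros)
  then show "continuous_on (S \<times> cbox 0 1) (\<lambda>(x, u). \<tau> (fst x + u * (snd x - fst x)))"
    by (simp add: case_prod_unfold)
qed

text \<open>The difference quotient of the loop, rescaled by a positive factor so that it neither vanishes
  nor jumps at the corner \<open>(0, 1)\<close>. Both formulas agree for \<open>0 < t - s < 1\<close>.\<close>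
definition "secant x = (if snd x - fst x \<le> 1 / 2 then chord (fst x) (snd x) / of_real (1 - (snd x - fst x))
   else - chord (snd x - 1) (fst x) / of_real (snd x - fst x))"
definition "triangle_params = {x :: real \<times> real. 0 \<le> fst x \<and> fst x \<le> snd x \<and> snd x \<le> 1}"

lemma secant: "\<gamma> t - \<gamma> s = of_real ((t - s) * (1 - (t - s))) * secant (s, t)"
  if "0 \<le> t - s" "t - s \<le> 1"
proof (cases "t - s \<le> 1 / 2")
  case True
  then have "of_real (1 - (t - s)) \<noteq> (0::complex)" by (simp only: of_real_eq_0_iff)
  then show ?thesis using True chord[of t s] unfolding secant_def by simp
next
  case False
  \<comment> \<open>After a shift by one period the chord runs from t - 1 to s. Its parameter length
    is 1 - (t - s), small near the corner, and its direction is reversed.\<close>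
  have "\<gamma> t = \<gamma> (t - 1)" using period[of "t - 1"] by simp
  then have "\<gamma> t - \<gamma> s = - of_real (1 - (t - s)) * chord (t - 1) s"
    using chord[of s "t - 1"] by (simp add: algebra_simps)
  moreover have "of_real (d * (1 - d)) * (- c / of_real d) = - of_real (1 - d) * c"
    if "d \<noteq> 0" for d :: real and c :: complex using that by (simp add: algebra_simps)
  from this[of "t - s"] have "of_real ((t - s) * (1 - (t - s))) * (- chord (t - 1) s / of_real (t - s))
    = - of_real (1 - (t - s)) * chord (t - 1) s" using False by fastforce
  moreover have "secant (s, t) = - chord (t - 1) s / of_real (t - s)" using False by (simp add: secant_def)
  ultimately show ?thesis by metis
qed

lemma secant_diag: "secant (t, t) = \<tau> t"
  by (simp add: secant_def chord_diag)

lemma secant_corner: "secant (0, 1) = - \<tau> 0"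
  by (simp add: secant_def chord_diag)

lemma convex_triangle: "convex triangle_params"
proof -
  have "triangle_params = {x. 0 \<le> fst x} \<inter> {x. fst x \<le> snd x} \<inter> {x. snd x \<le> 1}" by (auto simp: triangle_params_def)
  moreover have "convex {x :: real \<times> real. 0 \<le> fst x}" "convex {x :: real \<times> real. fst x \<le> snd x}"
      "convex {x :: real \<times> real. snd x \<le> 1}"
    by (auto simp: convex_alt intro!: add_nonneg_nonneg mult_nonneg_nonneg add_mono mult_left_mono convex_bound_le)
  ultimately show ?thesis by (metis convex_Int)
qed

lemma cont_secant: "continuous_on triangle_params secant"
proof -
  let ?S = "triangle_params \<inter> {x. snd x - fst x \<le> 1 / 2}" and ?T = "triangle_params \<inter> {x. 1 / 2 \<le> snd x - fst x}"
  have ct: "closed triangle_params"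
    unfolding triangle_params_def
    by (intro closed_Collect_conj closed_Collect_le continuous_intros)
  have "continuous_on (?S \<union> ?T) secant"
    unfolding secant_def
  proof (rule continuous_on_cases)
    show "closed ?S" "closed ?T"
      by (intro closed_Int ct closed_Collect_le continuous_intros)+
    show "continuous_on ?S (\<lambda>x. chord (fst x) (snd x) / of_real (1 - (snd x - fst x)))"
    proof (intro continuous_intros cont_chord ballI)
      fix x assume "x \<in> ?S"
      then have "1 - (snd x - fst x) \<noteq> 0" by auto
      then show "complex_of_real (1 - (snd x - fst x)) \<noteq> 0" by (simp only: of_real_eq_0_iff) simp
    qed
    have "continuous_on ?T (\<lambda>x. chord (fst (snd x - 1, fst x)) (snd (snd x - 1, fst x)))"
      by (rule continuous_on_compose2[OF cont_chord[of UNIV]]) (auto intro!: continuous_intros)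
    then have "continuous_on ?T (\<lambda>x. chord (snd x - 1) (fst x))" by simp
    then show "continuous_on ?T (\<lambda>x. - chord (snd x - 1) (fst x) / of_real (snd x - fst x))"
    proof (intro continuous_intros ballI)
      fix x assume "x \<in> ?T"
      then have "snd x - fst x \<noteq> 0" by auto
      then show "complex_of_real (snd x - fst x) \<noteq> 0" by (simp only: of_real_eq_0_iff) simp
    qed
    show "\<forall>x. x \<in> ?S \<and> \<not> snd x - fst x \<le> 1 / 2 \<or> x \<in> ?T \<and> snd x - fst x \<le> 1 / 2 \<longrightarrow>
        chord (fst x) (snd x) / of_real (1 - (snd x - fst x)) = - chord (snd x - 1) (fst x) / of_real (snd x - fst x)"
    proof (intro allI impI)
      fix x :: "real \<times> real" assume "x \<in> ?S \<and> \<not> snd x - fst x \<le> 1 / 2 \<or> x \<in> ?T \<and> snd x - fst x \<le> 1 / 2"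
      then have d: "snd x - fst x = 1 / 2" by auto
      have "\<gamma> (snd x) = \<gamma> (snd x - 1)" using period[of "snd x - 1"] by simp
      then have "of_real (snd x - fst x) * chord (fst x) (snd x) = - (of_real (fst x - (snd x - 1)) * chord (snd x - 1) (fst x))"
        using chord[of "snd x" "fst x"] chord[of "fst x" "snd x - 1"]
        by (metis minus_diff_eq)
      moreover have "fst x - (snd x - 1) = 1 / 2" using d by simp
      ultimately have "chord (fst x) (snd x) = - chord (snd x - 1) (fst x)" unfolding d by simp
      then show "chord (fst x) (snd x) / of_real (1 - (snd x - fst x)) = - chord (snd x - 1) (fst x) / of_real (snd x - fst x)"
        unfolding d by simp
    qed
  qed
  moreover have "?S \<union> ?T = triangle_params" by auto
  ultimately show ?thesis by simp
qed

lemma secant_nz: 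
  assumes "x \<in> triangle_params" shows "secant x \<noteq> 0"
proof -
  obtain s t where x: "x = (s, t)" by force
  consider "s = t" | "s = 0" "t = 1" | "s < t" "t - s < 1" 
    using assms unfolding x triangle_params_def by fastforce
  then show ?thesis
  proof cases
    case 1 then show ?thesis using x secant_diag \<tau>_nz by simp
  next
    case 2 then show ?thesis using x secant_corner \<tau>_nz by simp
  next
    case 3
    have "\<gamma> s \<noteq> \<gamma> t"
    proof
      assume "\<gamma> s = \<gamma> t"
      moreover have "s \<in> {0..1}" "t \<in> {0..1}" using assms x by (auto simp: triangle_params_def)
      ultimately show False using simple 3 unfolding simple_path_def loop_free_def by force
    qed
    then show ?thesis using secant[of t s] 3 x by auto
  qed
qed

end

text \<open>From a lowest point all chords point into the closed upper half-plane. A rightward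
  tangent there singles out the counterclockwise orientation.\<close>

locale bottom_loop = regular_loop +
  assumes bottom: "\<And>t. Im (\<gamma> 0) \<le> Im (\<gamma> t)" 
    and right: "Im (\<tau> 0) = 0" "0 < Re (\<tau> 0)"
begin

lemma edge: "\<gamma> t - \<gamma> 0 = of_real (t * (1 - t)) * secant (0, t)" if "t \<in> {0..1}"
  using secant[of t 0] that by simp

lemma Im_secant: 
  assumes "t \<in> {0..1}" shows "0 \<le> Im (secant (0, t))"
proof (cases "t = 0 \<or> t = 1")
  case True
  then show ?thesis using secant_corner secant_diag[of 0] right by auto
next
  case False
  then have "0 < t * (1 - t)" using assms by auto
  moreover have "Im (\<gamma> t - \<gamma> 0) = (t * (1 - t)) * Im (secant (0, t))"
    unfolding edge[OF assms] by (simp only: Im_complex_of_real Re_complex_of_real times_complex.sel)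
  ultimately show ?thesis using bottom[of t] mult_pos_neg[of "t * (1 - t)" "Im (secant (0, t))"] by force
qed

text \<open>A logarithm of \<open>secant\<close> exists on the whole triangle, so its increment
  along the diagonal, where \<open>secant\<close> is the tangent, is the sum over the two legs. Each
  leg gives \<i> times pi: on the first the direction moves through the upper half-plane from \<tau>
  0 to its negative, and the second repeats this with opposite sign.\<close>

lemma winding_number_tangent: "winding_number \<tau> 0 = 1"
proof -
  obtain L where L: "continuous_on triangle_params L" "\<And>x. x \<in> triangle_params \<Longrightarrow> secant x = exp (L x)"
    using continuous_logarithm_on_contractible[OF cont_secant convex_imp_contractible[OF convex_triangle]]
      secant_nz by metis
  have tri: "(0, t) \<in> triangle_params" "(t, 1) \<in> triangle_params" "(t, t) \<in> triangle_params" if "t \<in> {0..1}" for t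
    using that by (auto simp: triangle_params_def)
  have cL: "continuous_on {0..1} (\<lambda>t. L (0, t))" "continuous_on {0..1} (\<lambda>t. L (t, 1))"
    "continuous_on {0..1} (\<lambda>t. L (t, t))"
    by (rule continuous_on_compose2[OF L(1)]; use tri in \<open>auto intro!: continuous_intros\<close>)+
  have "L (0, 1) - L (0, 0) = \<i> * pi"
  proof (rule Ln_lift_upper_half_plane[of "\<lambda>t. L (0, t)" "Re (\<tau> 0)"])
    have re: "of_real (Re (\<tau> 0)) = \<tau> 0" using right by (simp add: complex_eq_iff)
    show "0 \<le> Im (exp (L (0, t)))" if "t \<in> {0..1}" for t
      using Im_secant[OF that] L(2)[OF tri(1)[OF that]] by simp
    show "exp (L (0, 0)) = of_real (Re (\<tau> 0))"
      using re secant_diag[of 0] L(2)[OF tri(1)[of 0]] by simp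
    show "exp (L (0, 1)) = - of_real (Re (\<tau> 0))"
      using re secant_corner L(2)[OF tri(1)[of 1]] by simp
  qed (use cL right in auto)
  moreover have "L (1, 1) - L (0, 1) = L (0, 1) - L (0, 0)"
  proof -
    \<comment> \<open>As \<gamma> 1 = \<gamma> 0, both chords join the same two points, in opposite
      directions. The endpoints are separate because the factor t (1 - t) vanishes there.\<close>
    have opp: "secant (t, 1) = - secant (0, t)" if t: "t \<in> {0..1}" for t
    proof (cases "t = 0 \<or> t = 1")
      case True
      then show ?thesis using secant_corner secant_diag[of 0] secant_diag[of 1] period_\<tau>[of 0] by auto
    next
      case False
      have "\<gamma> 1 = \<gamma> 0" using period[of 0] by simp
      moreover have "(1 - t) * (1 - (1 - t)) = t * (1 - t)" by (simp add: algebra_simps)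
      then have "\<gamma> 1 - \<gamma> t = of_real (t * (1 - t)) * secant (t, 1)"
        using secant[of 1 t] t by simp
      ultimately have "of_real (t * (1 - t)) * secant (t, 1) = of_real (t * (1 - t)) * (- secant (0, t))"
        using edge[OF t] by (metis minus_diff_eq mult_minus_right)
      moreover have "of_real (t * (1 - t)) \<noteq> (0::complex)" using False by (simp only: of_real_eq_0_iff) auto
      ultimately show ?thesis by (simp only: mult_cancel_left) blast
    qed
    have "L (1, 1) - L (0, 1) = L (0, 1) - L (0, 0)"
    proof -
      have "(\<lambda>t. L (t, 1) - L (0, t)) 1 = (\<lambda>t. L (t, 1) - L (0, t)) 0"
      proof (rule constant_of_exp_constant[of "{0..1::real}" "\<lambda>t. L (t, 1) - L (0, t)" "-1"])
        show "exp (L (t, 1) - L (0, t)) = - 1" if "t \<in> {0..1}" for t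
          using opp[OF that] L(2)[OF tri(1)[OF that]] L(2)[OF tri(2)[OF that]] by (simp add: exp_diff)
      qed (use cL in \<open>auto intro!: continuous_intros\<close>)
      then show ?thesis by (simp add: algebra_simps)
    qed
    then show ?thesis .
  qed
  ultimately have "L (1, 1) - L (0, 0) = 2 * of_real pi * \<i>" by (simp add: algebra_simps)
  moreover have "winding_number \<tau> 0 = (L (1, 1) - L (0, 0)) / (2 * of_real pi * \<i>)"
  proof (rule winding_number_exp_lift)
    show "\<tau> t = exp (L (t, t))" if "t \<in> {0..1}" for t
      using secant_diag L(2)[OF tri(3)[OF that]] by simp
  qed (rule cL)
  ultimately show ?thesis by simp
qed

end

section \<open>Orientation: winding number +1 about inside points\<close>

lemma cayley_parts:
  assumes "a + \<i> * of_real e \<noteq> 0"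
  shows "0 < Re ((a - \<i> * of_real e) / (a + \<i> * of_real e)) \<longleftrightarrow> \<bar>e\<bar> < norm a"
    and "0 < e \<Longrightarrow> 0 < Im ((a - \<i> * of_real e) / (a + \<i> * of_real e)) \<longleftrightarrow> Re a < 0"
    and "0 < e \<Longrightarrow> Im ((a - \<i> * of_real e) / (a + \<i> * of_real e)) < 0 \<longleftrightarrow> 0 < Re a"
proof -
  define N where "N = (norm (a + \<i> * of_real e))\<^sup>2"
  have N: "0 < N" using assms by (simp add: N_def)
  \<comment> \<open>With the denominator made real, the numerator is
    \<open>norm a ^ 2 - e ^ 2 - 2 * \<i> * e * Re a\<close>, from which all three signs are read
    off.\<close>
  have eq: "(a - \<i> * of_real e) / (a + \<i> * of_real e) = (a - \<i> * of_real e) * cnj (a + \<i> * of_real e) / of_real N"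
    unfolding N_def by (rule complex_div_cnj)
  have re: "Re ((a - \<i> * of_real e) / (a + \<i> * of_real e)) = ((norm a)\<^sup>2 - e\<^sup>2) / N"
    and im: "Im ((a - \<i> * of_real e) / (a + \<i> * of_real e)) = - 2 * e * Re a / N"
    unfolding eq cmod_power2 by (simp_all add: power2_eq_square algebra_simps)
  show "0 < Re ((a - \<i> * of_real e) / (a + \<i> * of_real e)) \<longleftrightarrow> \<bar>e\<bar> < norm a"
    unfolding re using N by (simp add: zero_less_divide_iff) (metis abs_norm_cancel power2_less_imp_less abs_le_square_iff not_less)
  show "0 < e \<Longrightarrow> 0 < Im ((a - \<i> * of_real e) / (a + \<i> * of_real e)) \<longleftrightarrow> Re a < 0"
    unfolding im using N by (simp add: zero_less_divide_iff mult_less_0_iff divide_less_0_iff)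
  show "0 < e \<Longrightarrow> Im ((a - \<i> * of_real e) / (a + \<i> * of_real e)) < 0 \<longleftrightarrow> 0 < Re a"
    unfolding im using N by (simp add: zero_less_divide_iff zero_less_mult_iff)
qed

context bottom_loop
begin

text \<open>The real part of \<open>secant (0, t)\<close> tends to that of \<tau> 0 at t = 0 and to
  its negative at t = 1: the curve leaves the base point to the right and returns from the
  left.\<close>

lemma local_sides:
  obtains \<delta> where "0 < \<delta>" "\<delta> < 1 / 2" "\<And>t. 0 < t \<Longrightarrow> t \<le> \<delta> \<Longrightarrow> 0 < Re (\<gamma> t - \<gamma> 0)"
    "\<And>t. 1 - \<delta> \<le> t \<Longrightarrow> t < 1 \<Longrightarrow> Re (\<gamma> t - \<gamma> 0) < 0"
proof -
  have c: "continuous_on {0..1} (\<lambda>t. Re (secant (0, t)))"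
    by (intro continuous_intros continuous_on_compose2[OF cont_secant]) (auto simp: triangle_params_def)
  have r0: "Re (secant (0, 0)) = Re (\<tau> 0)" "Re (secant (0, 1)) = - Re (\<tau> 0)"
    by (simp_all add: secant_diag secant_corner)
  obtain d1 where d1: "0 < d1" "\<And>t. t \<in> {0..1} \<Longrightarrow> dist t 0 < d1 \<Longrightarrow> dist (Re (secant (0, t))) (Re (\<tau> 0)) < Re (\<tau> 0)"
    using c[unfolded continuous_on_iff, rule_format, of 0 "Re (\<tau> 0)"] right(2) r0 by auto
  obtain d2 where d2: "0 < d2" "\<And>t. t \<in> {0..1} \<Longrightarrow> dist t 1 < d2 \<Longrightarrow> dist (Re (secant (0, t))) (- Re (\<tau> 0)) < Re (\<tau> 0)"
    using c[unfolded continuous_on_iff, rule_format, of 1 "Re (\<tau> 0)"] right(2) r0 by auto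
  define \<delta> where "\<delta> = min (1 / 4) (min (d1 / 2) (d2 / 2))"
  have re: "Re (\<gamma> t - \<gamma> 0) = (t * (1 - t)) * Re (secant (0, t))" if "t \<in> {0..1}" for t
    unfolding edge[OF that] by simp
  show ?thesis
  proof
    show "0 < \<delta>" "\<delta> < 1 / 2" using d1 d2 by (auto simp: \<delta>_def)
    show "0 < Re (\<gamma> t - \<gamma> 0)" if "0 < t" "t \<le> \<delta>" for t
    proof -
      have t: "t \<in> {0..1}" "dist t 0 < d1" "0 < t * (1 - t)" using that d1 by (auto simp: \<delta>_def)
      then have "0 < Re (secant (0, t))" using d1(2)[of t] by (simp add: dist_real_def)
      then show ?thesis using re[OF t(1)] t(3) by simp
    qed
    show "Re (\<gamma> t - \<gamma> 0) < 0" if "1 - \<delta> \<le> t" "t < 1" for t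
    proof -
      have t: "t \<in> {0..1}" "dist t 1 < d2" "0 < t * (1 - t)" using that d2 by (auto simp: \<delta>_def dist_real_def)
      then have "Re (secant (0, t)) < 0" using d2(2)[of t] by (simp add: dist_real_def)
      then show ?thesis using re[OF t(1)] t(3) by (simp add: mult_pos_neg)
    qed
  qed
qed

text \<open>The point \<open>\<i>\<epsilon>\<close> is compared with the exterior point \<open>-\<i>\<epsilon>\<close>: the Cayley quotient
  \<open>R\<close> crosses the cut of \<open>Ln\<close> only at the base point, from \<open>Im R > 0\<close> to \<open>Im R < 0\<close>.\<close>
lemma winding_number_above_bottom:
  obtains \<epsilon> where "0 < \<epsilon>" "\<gamma> 0 + \<i> * of_real \<epsilon> \<notin> path_image \<gamma>"
    "winding_number \<gamma> (\<gamma> 0 + \<i> * of_real \<epsilon>) = 1"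
proof -
  obtain \<delta> where \<delta>: "0 < \<delta>" "\<delta> < 1 / 2" and pos: "\<And>t. 0 < t \<Longrightarrow> t \<le> \<delta> \<Longrightarrow> 0 < Re (\<gamma> t - \<gamma> 0)"
    and neg: "\<And>t. 1 - \<delta> \<le> t \<Longrightarrow> t < 1 \<Longrightarrow> Re (\<gamma> t - \<gamma> 0) < 0"
    using local_sides by blast
  define \<zeta> where "\<zeta> = (\<lambda>t. \<gamma> t - \<gamma> 0)"
  have c\<zeta>: "continuous_on S \<zeta>" for S unfolding \<zeta>_def by (intro continuous_intros cont_\<gamma>)
  have Im\<zeta>: "0 \<le> Im (\<zeta> t)" for t using bottom by (simp add: \<zeta>_def)
  have \<zeta>01: "\<zeta> 0 = 0" "\<zeta> 1 = 0" using period[of 0] by (simp_all add: \<zeta>_def)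
  have \<zeta>nz: "\<zeta> t \<noteq> 0" if "0 < t" "t < 1" for t
    using edge[of t] secant_nz[of "(0, t)"] that by (auto simp: \<zeta>_def triangle_params_def)
  have "\<exists>m\<in>{\<delta>..1 - \<delta>}. \<forall>t\<in>{\<delta>..1 - \<delta>}. norm (\<zeta> m) \<le> norm (\<zeta> t)"
    using \<delta> by (intro continuous_attains_inf continuous_intros c\<zeta>) auto
  then obtain m where m: "m \<in> {\<delta>..1 - \<delta>}" "\<And>t. t \<in> {\<delta>..1 - \<delta>} \<Longrightarrow> norm (\<zeta> m) \<le> norm (\<zeta> t)" by blast
  \<comment> \<open>Half the smallest distance from the base point to the middle part of the curve,
    so that this part stays outside the circle of radius \<epsilon>, where the Cayley quotient has
    positive real part.\<close>
  define \<epsilon> where "\<epsilon> = norm (\<zeta> m) / 2"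
  have \<epsilon>: "0 < \<epsilon>" using \<zeta>nz[of m] m(1) \<delta> by (simp add: \<epsilon>_def)
  have far: "\<epsilon> < norm (\<zeta> t)" if "t \<in> {\<delta>..1 - \<delta>}" for t
    using m(2)[OF that] \<epsilon> unfolding \<epsilon>_def by linarith
  have den: "\<zeta> t + \<i> * of_real \<epsilon> \<noteq> 0" for t
    using Im\<zeta>[of t] \<epsilon> by (auto simp: complex_eq_iff)
  have num: "\<zeta> t - \<i> * of_real \<epsilon> \<noteq> 0" if t: "t \<in> {0..1}" for t
  proof -
    consider "t = 0 \<or> t = 1" | "0 < t" "t \<le> \<delta>" | "1 - \<delta> \<le> t" "t < 1" | "t \<in> {\<delta>..1 - \<delta>}"
      using t \<delta> by fastforce
    then show ?thesis
    proof cases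
      case 1 then show ?thesis using \<zeta>01 \<epsilon> by auto
    next
      case 2 then show ?thesis using pos[of t] by (auto simp: \<zeta>_def complex_eq_iff)
    next
      case 3 then show ?thesis using neg[of t] by (auto simp: \<zeta>_def complex_eq_iff)
    next
      case 4
      have "norm (\<i> * of_real \<epsilon>) = \<epsilon>" using \<epsilon> by (simp add: norm_mult)
      then show ?thesis using far[OF 4] by auto
    qed
  qed
  define R where "R = (\<lambda>t. (\<zeta> t - \<i> * of_real \<epsilon>) / (\<zeta> t + \<i> * of_real \<epsilon>))"
  have Rnz: "R t \<noteq> 0" if "t \<in> {0..1}" for t using num[OF that] den[of t] by (simp add: R_def)
  have cR: "continuous_on S R" for S unfolding R_def using den by (intro continuous_intros c\<zeta>) auto
  have R01: "R 0 = -1" "R 1 = -1" using \<zeta>01 \<epsilon> by (simp_all add: R_def)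
  have Rneg: "Im (R t) < 0" if "0 < t" "t \<le> \<delta>" for t
    using cayley_parts(3)[OF den \<epsilon>] pos[OF that] by (simp add: R_def \<zeta>_def)
  have Rpos: "0 < Im (R t)" if "1 - \<delta> \<le> t" "t < 1" for t
    using cayley_parts(2)[OF den \<epsilon>] neg[OF that] by (simp add: R_def \<zeta>_def)
  have Rmid: "0 < Re (R t)" if "t \<in> {\<delta>..1 - \<delta>}" for t
    using cayley_parts(1)[OF den[of t]] far[OF that] \<epsilon> by (simp add: R_def)
  \<comment> \<open>Near both ends R is close to -1, on the cut, so \<open>Ln\<close> is applied to
    -R and corrected by pi times \<i>. Entering through the lower half-plane requires a minus,
    leaving through the upper one a plus; hence q runs from -\<i> pi to \<i> pi.\<close>
  define q where "q = (\<lambda>t. if t \<le> \<delta> then Ln (- R t) - \<i> * pi else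
     (if t \<le> 1 - \<delta> then Ln (R t) else Ln (- R t) + \<i> * pi))"
  have "continuous_on ({0..\<delta>} \<union> ({\<delta>..1 - \<delta>} \<union> {1 - \<delta>..1})) q"
    unfolding q_def
  proof (rule continuous_on_cases)
    show "continuous_on {0..\<delta>} (\<lambda>t. Ln (- R t) - \<i> * pi)"
    proof (intro continuous_intros cR)
      fix t assume t: "t \<in> {0..\<delta>}"
      show "- R t \<notin> \<real>\<^sub>\<le>\<^sub>0"
        using Rneg[of t] R01 t by (cases "t = 0") (auto simp: complex_nonpos_Reals_iff)
    qed
    show "continuous_on ({\<delta>..1 - \<delta>} \<union> {1 - \<delta>..1}) (\<lambda>t. if t \<le> 1 - \<delta> then Ln (R t) else Ln (- R t) + \<i> * pi)"
    proof (rule continuous_on_cases)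
      show "continuous_on {\<delta>..1 - \<delta>} (\<lambda>t. Ln (R t))"
      proof (intro continuous_on_Ln' cR)
        show "R t \<notin> \<real>\<^sub>\<le>\<^sub>0" if "t \<in> {\<delta>..1 - \<delta>}" for t
          using Rmid[OF that] by (simp add: complex_nonpos_Reals_iff)
      qed
      show "continuous_on {1 - \<delta>..1} (\<lambda>t. Ln (- R t) + \<i> * pi)"
      proof (intro continuous_intros cR)
        fix t assume t: "t \<in> {1 - \<delta>..1}"
        show "- R t \<notin> \<real>\<^sub>\<le>\<^sub>0"
          using Rpos[of t] R01 t by (cases "t = 1") (auto simp: complex_nonpos_Reals_iff)
      qed
      show "\<forall>t. t \<in> {\<delta>..1 - \<delta>} \<and> \<not> t \<le> 1 - \<delta> \<or> t \<in> {1 - \<delta>..1} \<and> t \<le> 1 - \<delta> \<longrightarrow> Ln (R t) = Ln (- R t) + \<i> * pi"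
        using Rpos[of "1 - \<delta>"] \<delta> Rnz[of "1 - \<delta>"] by (auto simp: Ln_minus)
    qed auto
    show "\<forall>t. t \<in> {0..\<delta>} \<and> \<not> t \<le> \<delta> \<or> t \<in> {\<delta>..1 - \<delta>} \<union> {1 - \<delta>..1} \<and> t \<le> \<delta>
        \<longrightarrow> Ln (- R t) - \<i> * pi = (if t \<le> 1 - \<delta> then Ln (R t) else Ln (- R t) + \<i> * pi)"
      using Rneg[of \<delta>] \<delta> Rnz[of \<delta>] by (auto simp: Ln_minus)
  qed auto
  moreover have "{0..\<delta>} \<union> ({\<delta>..1 - \<delta>} \<union> {1 - \<delta>..1}) = {0..1}" using \<delta> by auto
  ultimately have cq: "continuous_on {0..1} q" by simp
  have "winding_number R 0 = (q 1 - q 0) / (2 * of_real pi * \<i>)"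
  proof (rule winding_number_exp_lift[OF cq])
    show "R t = exp (q t)" if "t \<in> {0..1}" for t
      using Rnz[OF that] by (simp add: q_def exp_diff exp_add)
  qed
  also have "\<dots> = 1" using \<delta> R01 by (simp add: q_def)
  finally have wR: "winding_number R 0 = 1" .
  let ?u = "\<lambda>t. \<zeta> t + \<i> * of_real \<epsilon>"
  \<comment> \<open>Seen from the point \<epsilon> below the base point, the curve stays strictly in
    the upper half-plane and cannot wind.\<close>
  have wu: "winding_number ?u 0 = 0"
  proof (rule winding_number_exp_lift_loop)
    show "continuous_on {0..1} (\<lambda>t. Ln (?u t / \<i>) + Ln \<i>)"
    proof (intro continuous_intros c\<zeta>)
      show "?u t / \<i> \<notin> \<real>\<^sub>\<le>\<^sub>0" for t
        using Im\<zeta>[of t] \<epsilon> by (auto simp: complex_nonpos_Reals_iff)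
    qed auto
    show "?u t = exp (Ln (?u t / \<i>) + Ln \<i>)" for t
    proof -
      have "?u t / \<i> \<noteq> 0" using den[of t] by simp
      then have "exp (Ln (?u t / \<i>)) * exp (Ln \<i>) = ?u t / \<i> * \<i>"
        using exp_Ln complex_i_not_zero by presburger
      moreover have "?u t / \<i> * \<i> = ?u t" by (simp add: complex_eq_iff)
      ultimately show ?thesis by (simp only: exp_add)
    qed
  qed (simp add: \<zeta>01)
  have "winding_number \<gamma> (\<gamma> 0 + \<i> * of_real \<epsilon>) = winding_number (\<lambda>t. \<gamma> t - (\<gamma> 0 + \<i> * of_real \<epsilon>)) 0"
    by (rule winding_number_offset)
  also have "\<dots> = winding_number (\<lambda>t. R t * ?u t) 0"
  proof (rule winding_number_cong)
    fix t :: real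
    have "R t * ?u t = \<zeta> t - \<i> * of_real \<epsilon>" using den[of t] by (simp add: R_def)
    then show "\<gamma> t - (\<gamma> 0 + \<i> * of_real \<epsilon>) = R t * ?u t" by (simp add: \<zeta>_def)
  qed
  also have "\<dots> = winding_number R 0 + winding_number ?u 0"
    by (rule winding_number_mult[OF cR Rnz]) (use den in \<open>auto intro!: continuous_intros c\<zeta>\<close>)
  also have "\<dots> = 1" unfolding wR wu by simp
  finally have "winding_number \<gamma> (\<gamma> 0 + \<i> * of_real \<epsilon>) = 1" .
  moreover have "\<gamma> 0 + \<i> * of_real \<epsilon> \<notin> path_image \<gamma>"
  proof
    assume "\<gamma> 0 + \<i> * of_real \<epsilon> \<in> path_image \<gamma>"
    then obtain t where t: "t \<in> {0..1}" "\<gamma> 0 + \<i> * of_real \<epsilon> = \<gamma> t" unfolding path_image_def by blast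
    from t(2)[symmetric] show False using num[OF t(1)] by (simp add: \<zeta>_def)
  qed
  ultimately show ?thesis using that \<epsilon> by blast
qed

text \<open>For a simple closed curve the inside has one common winding number, 1 or -1, so a single
  point with value 1 decides the sign. That point is not outside because its winding number is not
  0.\<close>

lemma winding_number_inside:
  assumes "z \<in> inside (path_image \<gamma>)"
  shows "winding_number \<gamma> z = 1"
proof -
  obtain \<epsilon> where e: "\<gamma> 0 + \<i> * of_real \<epsilon> \<notin> path_image \<gamma>"
    "winding_number \<gamma> (\<gamma> 0 + \<i> * of_real \<epsilon>) = 1" using winding_number_above_bottom by blast
  then have "\<gamma> 0 + \<i> * of_real \<epsilon> \<notin> outside (path_image \<gamma>)"
    using winding_number_zero_in_outside[OF path loop] by auto
  then have "\<gamma> 0 + \<i> * of_real \<epsilon> \<in> inside (path_image \<gamma>)"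
    using e inside_Un_outside by blast
  then show ?thesis
    using simple_closed_path_winding_number_inside[OF simple] e(2) assms
    by (metis one_neq_neg_one)
qed

end

section \<open>Moving the base point to a lowest point\<close>

context regular_loop
begin

lemma period_int: "\<gamma> (t + of_int n) = \<gamma> t"
proof (induction n rule: int_induct[where k = 0])
  case (step1 i)
  then show ?case using period[of "t + of_int i"] by (simp add: add.assoc)
next
  case (step2 i)
  then show ?case using period[of "t + of_int (i - 1)"] by (simp add: algebra_simps)
qed simp

lemma eq_at_frac: "\<gamma> (frac t) = \<gamma> t"
  using period_int[of "frac t" "\<lfloor>t\<rfloor>"] by (simp add: frac_def)

lemma path_image_eq_range: "path_image \<gamma> = range \<gamma>"
proof
  show "range \<gamma> \<subseteq> path_image \<gamma>"
  proof
    fix z assume "z \<in> range \<gamma>"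
    then obtain t where "z = \<gamma> (frac t)" using eq_at_frac by force
    moreover have "frac t \<in> {0..1}" using frac_ge_0[of t] frac_lt_1[of t] by simp
    ultimately show "z \<in> path_image \<gamma>" unfolding path_image_def by blast
  qed
qed (auto simp: path_image_def)

lemma eq_imp_diff_Ints: 
  assumes "\<gamma> x = \<gamma> y" shows "x - y \<in> \<int>"
proof -
  have "frac x = frac y"
    using inj by (rule inj_onD) (use assms eq_at_frac frac_ge_0 frac_lt_1 in auto)
  then have "x - y = of_int (\<lfloor>x\<rfloor> - \<lfloor>y\<rfloor>)" by (simp add: frac_def)
  then show ?thesis by (metis Ints_of_int)
qed

lemma reparametrize:
  assumes "s = 1 \<or> s = -1"
  shows "regular_loop (\<lambda>t. \<gamma> (t0 + s * t)) (\<lambda>t. s *\<^sub>R \<tau> (t0 + s * t))"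
proof
  fix t :: real
  have "((\<gamma> \<circ> (\<lambda>t. t0 + s * t)) has_vector_derivative s *\<^sub>R \<tau> (t0 + s * t)) (at t)"
    by (rule vector_diff_chain_at) (auto intro!: derivative_eq_intros deriv)
  then show "((\<lambda>t. \<gamma> (t0 + s * t)) has_vector_derivative s *\<^sub>R \<tau> (t0 + s * t)) (at t)"
    by (simp add: o_def)
  show "s *\<^sub>R \<tau> (t0 + s * t) \<noteq> 0" using assms \<tau>_nz by auto
  show "\<gamma> (t0 + s * (t + 1)) = \<gamma> (t0 + s * t)"
    using assms period_int[of "t0 + t" 1] period_int[of "t0 - t" "-1"] by (auto simp: algebra_simps)
next
  show "continuous_on UNIV (\<lambda>t. s *\<^sub>R \<tau> (t0 + s * t))"
    by (intro continuous_intros continuous_on_compose2[OF cont_\<tau>]) auto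
  show "inj_on (\<lambda>t. \<gamma> (t0 + s * t)) {0..<1}"
  proof (rule inj_onI)
    fix x y :: real assume xy: "x \<in> {0..<1}" "y \<in> {0..<1}" "\<gamma> (t0 + s * x) = \<gamma> (t0 + s * y)"
    have "(t0 + s * x) - (t0 + s * y) \<in> \<int>" by (rule eq_imp_diff_Ints[OF xy(3)])
    then have "x - y \<in> \<int>" using assms by (metis (no_types, opaque_lifting) Ints_minus add_diff_cancel_left minus_diff_eq mult_1 mult_minus1 minus_diff_minus)
    then obtain z where z: "x - y = of_int z" by (rule Ints_cases)
    then have "\<bar>real_of_int z\<bar> < 1" using xy(1,2) by auto
    then have "z = 0" by linarith
    then show "x = y" using z by simp
  qed
qed

lemma obtain_bottom_loop:
  obtains \<gamma>' \<tau>' where "bottom_loop \<gamma>' \<tau>'" "path_image \<gamma>' = path_image \<gamma>"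
proof -
  have "\<exists>t\<in>{0..1}. \<forall>u\<in>{0..1}. Im (\<gamma> t) \<le> Im (\<gamma> u)"
    by (intro continuous_attains_inf continuous_intros cont_\<gamma>) auto
  then obtain t0 where t0: "\<And>u. u \<in> {0..1} \<Longrightarrow> Im (\<gamma> t0) \<le> Im (\<gamma> u)" by blast
  have low: "Im (\<gamma> t0) \<le> Im (\<gamma> u)" for u
    using t0[of "frac u"] eq_at_frac[of u] frac_ge_0[of u] frac_lt_1[of u] by simp
  have "((\<lambda>t. Im (\<gamma> t)) has_real_derivative Im (\<tau> t0)) (at t0)"
    unfolding has_real_derivative_iff_has_vector_derivative
    by (rule bounded_linear.has_vector_derivative[OF bounded_linear_Im deriv])
  then have Im0: "Im (\<tau> t0) = 0"
    by (rule DERIV_local_min[of _ _ _ 1]) (use low in auto)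
  then have Re0: "Re (\<tau> t0) \<noteq> 0" using \<tau>_nz[of t0] by (auto simp: complex_eq_iff)
  \<comment> \<open>At the minimum of the height the tangent is horizontal; s reverses the curve
    when it points to the left.\<close>
  define s where "s = sgn (Re (\<tau> t0))"
  have s: "s = 1 \<or> s = -1" "0 < s * Re (\<tau> t0)"
    using Re0 by (auto simp: s_def sgn_real_def)
  interpret r: regular_loop "\<lambda>t. \<gamma> (t0 + s * t)" "\<lambda>t. s *\<^sub>R \<tau> (t0 + s * t)"
    by (rule reparametrize[OF s(1)])
  have "bottom_loop (\<lambda>t. \<gamma> (t0 + s * t)) (\<lambda>t. s *\<^sub>R \<tau> (t0 + s * t))"
    by unfold_locales (use low Im0 s in auto)
  moreover have "path_image (\<lambda>t. \<gamma> (t0 + s * t)) = path_image \<gamma>"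
  proof -
    have "surj (\<lambda>t. t0 + s * t)"
      using s(1) by (intro surjI[of _ "\<lambda>u. (u - t0) / s"]) auto
    then have "range (\<lambda>t. \<gamma> (t0 + s * t)) = range \<gamma>" by (metis image_image)
    then show ?thesis unfolding r.path_image_eq_range path_image_eq_range .
  qed
  ultimately show ?thesis by (rule that)
qed

end

section \<open>The field of a symplectomorphism fixing the boundary\<close>

lemma smooth_curve_regular_loop:
  assumes "smooth_simple_closed_curve \<gamma>"
  shows "regular_loop \<gamma> (\<lambda>t. vector_derivative \<gamma> (at t))"
proof
  note a = assms[unfolded smooth_simple_closed_curve_def]
  have d: "curve_deriv n \<gamma> differentiable (at t)" for n t using a by blast
  show "(\<gamma> has_vector_derivative vector_derivative \<gamma> (at t)) (at t)" for t
    using d[of 0 t] by (simp add: vector_derivative_works[symmetric])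
  show "continuous_on UNIV (\<lambda>t. vector_derivative \<gamma> (at t))"
    using d[of "Suc 0"] by (simp add: continuous_at_imp_continuous_on differentiable_imp_continuous_within)
qed (use assms in \<open>auto simp: smooth_simple_closed_curve_def\<close>)

text \<open>The derivative of F with respect to z. Its counterpart with respect to
  \<open>cnj z\<close> is \<open>conf_field F z / 2\<close>, so conformal points are the zeros of
  the latter.\<close>

definition wirtinger :: "(complex \<Rightarrow> complex) \<Rightarrow> complex \<Rightarrow> complex" where
  "wirtinger F z = (dir_deriv 1 F z - \<i> * dir_deriv \<i> F z) / 2"

lemma conf_field_eq: "conf_field F z = dir_deriv 1 F z + \<i> * dir_deriv \<i> F z"
  by (simp add: conf_field_def f_x_def f_y_def g_x_def g_y_def complex_eq_iff)

lemma conformal_point_iff: "conformal_point F z \<longleftrightarrow> conf_field F z = 0"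
  by (auto simp: conformal_point_def conf_field_def complex_eq_iff)

lemma trace_eq: "f_x F z + g_y F z = 2 * Re (wirtinger F z)"
  by (simp add: wirtinger_def f_x_def g_y_def)

lemma det_eq: "f_x F z * g_y F z - f_y F z * g_x F z = (norm (wirtinger F z))\<^sup>2 - (norm (conf_field F z / 2))\<^sup>2"
  unfolding cmod_power2 wirtinger_def conf_field_eq f_x_def f_y_def g_x_def g_y_def
  by (simp add: power2_eq_square field_simps)

lemma has_derivative_wirtinger:
  assumes "F differentiable (at z)"
  shows "(F has_derivative (\<lambda>v. wirtinger F z * v + conf_field F z / 2 * cnj v)) (at z)"
proof -
  let ?D = "frechet_derivative F (at z)"
  have D: "(F has_derivative ?D) (at z)" using assms frechet_derivative_works by blast
  then interpret bounded_linear ?D by (rule has_derivative_bounded_linear)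
  have "?D v = wirtinger F z * v + conf_field F z / 2 * cnj v" for v
  proof -
    have "v = Re v *\<^sub>R 1 + Im v *\<^sub>R \<i>" by (simp add: complex_eq_iff)
    then have "?D v = Re v *\<^sub>R ?D 1 + Im v *\<^sub>R ?D \<i>" by (metis add scaleR)
    then show ?thesis
      unfolding wirtinger_def conf_field_eq dir_deriv_def
      by (simp add: complex_eq_iff field_simps)
  qed
  then have "?D = (\<lambda>v. wirtinger F z * v + conf_field F z / 2 * cnj v)" by blast
  with D show ?thesis by simp
qed

lemma smooth_on_continuous:
  assumes "open U" "smooth_on U F"
  shows "\<And>z. z \<in> U \<Longrightarrow> F differentiable (at z)" "continuous_on U (wirtinger F)" "continuous_on U (conf_field F)"
proof -
  have d: "iter_dir_deriv vs F differentiable_on U" if "set vs \<subseteq> {1, \<i>}" for vs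
    using assms(2) that unfolding smooth_on_def by blast
  show "F differentiable (at z)" if "z \<in> U" for z
    using d[of "[]"] that assms(1) by (simp add: differentiable_on_eq_differentiable_at)
  have c: "continuous_on U (dir_deriv 1 F)" "continuous_on U (dir_deriv \<i> F)"
    using d[of "[1]"] d[of "[\<i>]"] by (auto intro: differentiable_imp_continuous_on)
  show "continuous_on U (wirtinger F)" unfolding wirtinger_def by (intro continuous_intros c) auto
  show "continuous_on U (conf_field F)" unfolding conf_field_eq by (intro continuous_intros c)
qed

text \<open>The coefficients of dw are (1 + a) / 2 and b / 2. Determinant 1 gives
  \<open>norm (1 + a) ^ 2 - norm b ^ 2 = 2 + 2 * Re a\<close>, which is 2 plus the trace. Positivity
  of the moderateness expression thus says that the complex-linear part of dw dominates, as
  \<open>local_chart\<close> demands.\<close>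

lemma fillable_conf_index:
  assumes "open U" "smooth_on U F" "p \<in> U" "f_x F p * g_y F p - f_y F p * g_x F p = 1"
    "0 < 2 + f_x F p + g_y F p" "0 < e1" "\<And>z. z \<in> ball p e1 \<Longrightarrow> z \<noteq> p \<Longrightarrow> conf_field F z \<noteq> 0"
  shows "fillable (conf_field F) p (conf_index F p)"
proof -
  note sm = smooth_on_continuous[OF assms(1,2)]
  define a where "a = wirtinger F" define b where "b = (\<lambda>z. conf_field F z / 2)"
  define A where "A = (1 + a p) / 2"
  \<comment> \<open>The midpoint between the sizes of the antilinear and the linear part of dw at p;
    the gap absorbs the variation of a and b near p.\<close>
  define B where "B = (norm (b p) / 2 + norm A) / 2"
  have det: "(norm (a p))\<^sup>2 - (norm (b p))\<^sup>2 = 1" using assms(4) unfolding det_eq a_def b_def .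
  have "0 < 2 + 2 * Re (a p)" using assms(5) trace_eq[of F p] by (simp add: a_def)
  moreover have "(norm (1 + a p))\<^sup>2 = 1 + 2 * Re (a p) + (norm (a p))\<^sup>2"
    unfolding cmod_power2 by (simp add: power2_eq_square algebra_simps)
  ultimately have "(norm (b p))\<^sup>2 < (norm (1 + a p))\<^sup>2" using det by linarith
  then have "norm (b p) < norm (1 + a p)" by (rule power2_less_imp_less) simp
  then have bA: "norm (b p) / 2 < norm A" by (simp add: A_def norm_divide)
  then have B: "B < norm A" "norm (b p) / 2 < B" by (auto simp: B_def)
  have ca: "continuous_on U a" and cb: "continuous_on U b"
    unfolding a_def b_def using sm by (auto intro!: continuous_intros)
  \<comment> \<open>A bound for the operator norm of the derivative of
    \<open>wcoord F z - A * z\<close>, to which the mean value inequality is applied below.\<close>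
  define n where "n = (\<lambda>z. (norm (a z - a p) + norm (b z)) / 2)"
  have "continuous_on U n"
    unfolding n_def by (intro continuous_intros ca cb) auto
  then have "continuous (at p) n"
    using assms(1,3) continuous_on_eq_continuous_at by blast
  then have "(n \<longlongrightarrow> n p) (nhds p)"
    unfolding continuous_at tendsto_at_iff_tendsto_nhds .
  moreover have "n p < B" using B(2) by (simp add: n_def)
  ultimately have "\<forall>\<^sub>F z in nhds p. n z < B" by (rule order_tendstoD(2))
  then obtain e2 where e2: "0 < e2" "\<And>z. z \<in> ball p e2 \<Longrightarrow> (norm (a z - a p) + norm (b z)) / 2 < B"
    unfolding eventually_nhds_metric n_def by (auto simp: dist_commute)
  obtain e3 where e3: "0 < e3" "ball p e3 \<subseteq> U" using assms(1,3) open_contains_ball by blast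
  define e0 where "e0 = min e1 (min e2 e3)"
  have e0: "0 < e0" "ball p e0 \<subseteq> ball p e1" "ball p e0 \<subseteq> ball p e2" "ball p e0 \<subseteq> ball p e3"
    using assms(6) e2 e3 by (auto simp: e0_def)
  interpret local_chart "wcoord F" p A B e0 "conf_field F"
  proof
    show "0 < e0" "B < norm A" by fact+
    show "continuous_on (ball p e0) (conf_field F)" using sm(3) e0(4) e3(2) by (meson continuous_on_subset order_trans)
    show "conf_field F z \<noteq> 0" if "z \<in> ball p e0" "z \<noteq> p" for z using that assms(7) e0(2) by blast
    fix z z' assume z: "z \<in> ball p e0" "z' \<in> ball p e0"
    have "norm ((\<lambda>z. wcoord F z - A * z) z - (\<lambda>z. wcoord F z - A * z) z') \<le> B * norm (z - z')"
    proof (rule differentiable_bound[OF convex_ball _ _ z])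
      fix x assume x: "x \<in> ball p e0"
      have "F differentiable (at x)" using sm(1) x e0(4) e3(2) by blast
      from has_derivative_wirtinger[OF this]
      have "(F has_derivative (\<lambda>v. a x * v + b x * cnj v)) (at x within ball p e0)"
        unfolding a_def b_def by (rule has_derivative_at_withinI)
      then have "((\<lambda>z. 1 / 2 * (z + F z) - A * z) has_derivative
          (\<lambda>v. 1 / 2 * (v + (a x * v + b x * cnj v)) - A * v)) (at x within ball p e0)"
        by (intro derivative_intros)
      moreover have "(\<lambda>v. 1 / 2 * (v + (a x * v + b x * cnj v)) - A * v)
          = (\<lambda>v. ((a x - a p) * v + b x * cnj v) / 2)"
        by (simp add: A_def algebra_simps add_divide_distrib diff_divide_distrib)
      moreover have "wcoord F = (\<lambda>z. 1 / 2 * (z + F z))" by (auto simp: wcoord_def)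
      ultimately show "((\<lambda>z. wcoord F z - A * z) has_derivative (\<lambda>v. ((a x - a p) * v + b x * cnj v) / 2)) (at x within ball p e0)"
        by (simp only:)
      show "onorm (\<lambda>v. ((a x - a p) * v + b x * cnj v) / 2) \<le> B"
      proof (rule onorm_le)
        fix v
        have "norm (((a x - a p) * v + b x * cnj v) / 2) \<le> (norm ((a x - a p) * v) + norm (b x * cnj v)) / 2"
          using norm_triangle_ineq by (simp add: norm_divide)
        also have "\<dots> = (norm (a x - a p) + norm (b x)) / 2 * norm v"
          by (simp add: norm_mult distrib_right add_divide_distrib)
        also have "\<dots> \<le> B * norm v"
          using e2(2)[of x] x e0(3) by (intro mult_right_mono) auto
        finally show "norm (((a x - a p) * v + b x * cnj v) / 2) \<le> B * norm v" .
      qed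
    qed
    then show "norm (wcoord F z - wcoord F z' - A * (z - z')) \<le> B * norm (z - z')"
      by (simp add: algebra_simps)
  qed
  have "conf_index F p = index" unfolding conf_index_def by (rule index_eq)
  then show ?thesis using fillable_index by simp
qed

context bottom_loop
begin

text \<open>Differentiating F \<gamma> = \<gamma> gives
  \<open>b * cnj \<tau> = (1 - a) * \<tau>\<close>, hence b and 1 - a have equal norm. The
  determinant then reads 1 = 2 Re a - 1. So 1 - a is imaginary, and b / \<tau>^2 is 1 - a divided by
  the positive number |\<tau>|^2.\<close>

lemma derivative_on_fixed_loop:
  assumes F: "F differentiable (at (\<gamma> t))" and fixed: "\<And>s. F (\<gamma> s) = \<gamma> s"
    and det: "f_x F (\<gamma> t) * g_y F (\<gamma> t) - f_y F (\<gamma> t) * g_x F (\<gamma> t) = 1"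
  shows "Re (wirtinger F (\<gamma> t)) = 1" "Re (conf_field F (\<gamma> t) / (\<tau> t)\<^sup>2) = 0"
proof -
  define a where "a = wirtinger F (\<gamma> t)" define b where "b = conf_field F (\<gamma> t) / 2"
  have "(\<gamma> has_derivative (\<lambda>h. h *\<^sub>R \<tau> t)) (at t)"
    using deriv[of t] by (simp add: has_vector_derivative_def)
  from diff_chain_at[OF this has_derivative_wirtinger[OF F]]
  have "(\<gamma> has_derivative (\<lambda>h. a * (h *\<^sub>R \<tau> t) + b * cnj (h *\<^sub>R \<tau> t))) (at t)"
    by (simp only: o_def fixed a_def b_def)
  then have "(\<gamma> has_vector_derivative a * \<tau> t + b * cnj (\<tau> t)) (at t)"
    unfolding has_vector_derivative_def by (simp add: algebra_simps scaleR_conv_of_real)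
  then have eq: "a * \<tau> t + b * cnj (\<tau> t) = \<tau> t"
    using deriv[of t] vector_derivative_at by metis
  then have eq': "b * cnj (\<tau> t) = (1 - a) * \<tau> t" by (simp add: algebra_simps)
  then have "norm b * norm (\<tau> t) = norm (1 - a) * norm (\<tau> t)" by (metis norm_mult complex_mod_cnj)
  then have "norm b = norm (1 - a)" using \<tau>_nz[of t] by simp
  moreover have "(norm a)\<^sup>2 - (norm b)\<^sup>2 = 1" using det unfolding det_eq a_def b_def .
  moreover have "(norm (1 - a))\<^sup>2 = 1 - 2 * Re a + (norm a)\<^sup>2"
    unfolding cmod_power2 by (simp add: power2_eq_square algebra_simps)
  ultimately show re: "Re (wirtinger F (\<gamma> t)) = 1" unfolding a_def[symmetric] by simp
  have n: "cnj (\<tau> t) * \<tau> t = of_real ((norm (\<tau> t))\<^sup>2)" by (metis complex_norm_square mult.commute)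
  have "conf_field F (\<gamma> t) / (\<tau> t)\<^sup>2 = 2 * (b * cnj (\<tau> t)) / (cnj (\<tau> t) * \<tau> t * \<tau> t)"
    using \<tau>_nz[of t] by (simp add: b_def power2_eq_square)
  also have "\<dots> = 2 * (1 - a) / of_real ((norm (\<tau> t))\<^sup>2)"
    unfolding eq' n using \<tau>_nz[of t] by simp
  finally show "Re (conf_field F (\<gamma> t) / (\<tau> t)\<^sup>2) = 0"
    using re unfolding a_def by (simp add: Re_divide_of_real)
qed

lemma winding_number_conf_field:
  assumes U: "open U" "smooth_on U F" "path_image \<gamma> \<subseteq> U" 
    and fixed: "\<And>z. z \<in> path_image \<gamma> \<Longrightarrow> F z = z"
    and det: "\<And>z. z \<in> path_image \<gamma> \<Longrightarrow> f_x F z * g_y F z - f_y F z * g_x F z = 1"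
    and nz: "\<And>z. z \<in> path_image \<gamma> \<Longrightarrow> conf_field F z \<noteq> 0"
  shows "winding_number (conf_field F \<circ> \<gamma>) 0 = 2"
proof -
  note sm = smooth_on_continuous[OF U(1,2)]
  have on: "\<gamma> t \<in> path_image \<gamma>" for t by (simp add: path_image_eq_range)
  let ?X = "\<lambda>t. conf_field F (\<gamma> t) / (\<tau> t)\<^sup>2"
  have X0: "Re (?X t) = 0" for t
    using derivative_on_fixed_loop(2)[of F t] sm(1) U(3) on fixed det by blast
  have Xnz: "?X t \<noteq> 0" for t using nz[OF on] \<tau>_nz by simp
  have c\<tau>: "continuous_on S \<tau>" for S using cont_\<tau> continuous_on_subset by blast
  have "continuous_on {0..1} (\<lambda>t. conf_field F (\<gamma> t))"
    by (rule continuous_on_compose2[OF sm(3) cont_\<gamma>]) (use on U(3) in auto)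
  then have cX: "continuous_on {0..1} ?X" using \<tau>_nz by (intro continuous_intros c\<tau>) auto
  \<comment> \<open>A nonvanishing imaginary function never meets the cut of \<open>Ln\<close>, so
    its logarithm closes up.\<close>
  have wX: "winding_number ?X 0 = 0"
  proof (rule winding_number_exp_lift_loop)
    show "continuous_on {0..1} (\<lambda>t. Ln (?X t))"
    proof (intro continuous_on_Ln' cX)
      show "?X t \<notin> \<real>\<^sub>\<le>\<^sub>0" for t
        using X0[of t] Xnz[of t] by (auto simp: complex_nonpos_Reals_iff complex_eq_iff simp del: divide_eq_0_iff)
    qed
    show "?X t = exp (Ln (?X t))" for t by (rule exp_Ln[OF Xnz, symmetric])
    show "Ln (?X 0) = Ln (?X 1)" using period[of 0] period_\<tau>[of 0] by simp
  qed
  have "winding_number (conf_field F \<circ> \<gamma>) 0 = winding_number (\<lambda>t. ?X t * (\<tau> t * \<tau> t)) 0"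
    by (rule winding_number_cong) (simp add: \<tau>_nz power2_eq_square)
  also have "\<dots> = winding_number ?X 0 + winding_number (\<lambda>t. \<tau> t * \<tau> t) 0"
    by (rule winding_number_mult[OF cX Xnz]) (use \<tau>_nz in \<open>auto intro!: continuous_intros c\<tau>\<close>)
  also have "winding_number (\<lambda>t. \<tau> t * \<tau> t) 0 = winding_number \<tau> 0 + winding_number \<tau> 0"
    by (rule winding_number_mult) (use \<tau>_nz c\<tau> in auto)
  finally show ?thesis by (simp only: wX winding_number_tangent one_add_one add_0)
qed

lemma sum_conf_index:
  assumes D: "D = path_image \<gamma> \<union> inside (path_image \<gamma>)"
    and U: "open U" "smooth_on U F" "D \<subseteq> U" and moderate: "moderate D F"
    and det: "\<And>z. z \<in> D \<Longrightarrow> f_x F z * g_y F z - f_y F z * g_x F z = 1"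
    and fixed: "\<And>z. z \<in> path_image \<gamma> \<Longrightarrow> F z = z"
    and nz: "\<And>z. z \<in> path_image \<gamma> \<Longrightarrow> \<not> conformal_point F z"
    and fin: "finite {z \<in> interior D. conformal_point F z}"
  shows "(\<Sum>p\<in>{z \<in> interior D. conformal_point F z}. conf_index F p) = 2"
proof -
  let ?Z = "{z \<in> interior D. conformal_point F z}"
  note sm = smooth_on_continuous[OF U(1,2)]
  have J: "open (inside (path_image \<gamma>))" "connected (inside (path_image \<gamma>))"
    "bounded (inside (path_image \<gamma>))" "frontier (inside (path_image \<gamma>)) = path_image \<gamma>"
    using Jordan_inside_outside[OF simple loop] by auto
  have "D = closure (inside (path_image \<gamma>))"
    unfolding D closure_Un_frontier J(4) by (rule Un_commute)
  then have cD: "compact D" and conD: "connected D"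
    using J by (auto intro: connected_imp_connected_closure)
  have conD': "connected (- D)"
    unfolding D union_with_inside using connected_outside[of "path_image \<gamma>"] path
    by (simp add: bounded_path_image)
  have on: "\<gamma> 0 \<in> path_image \<gamma>" "path_image \<gamma> \<subseteq> D" by (auto simp: path_image_eq_range D)
  \<comment> \<open>The sum runs over \<open>interior D\<close>, whereas winding numbers are known
    on \<open>inside\<close>. Zeros lie in both because there are none on the curve.\<close>
  have zero_in: "z \<in> ?Z \<and> z \<in> inside (path_image \<gamma>)" if "z \<in> D" "conf_field F z = 0" for z
  proof -
    have c: "conformal_point F z" using that by (simp add: conformal_point_iff)
    then have i: "z \<in> inside (path_image \<gamma>)" using nz[of z] that D by blast
    then have "z \<in> interior D" using J(1) D by (meson Un_upper2 interior_maximal subsetD)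
    then show ?thesis using c i by simp
  qed
  have Z: "z \<in> D" "conf_field F z = 0" "z \<in> inside (path_image \<gamma>)" if "z \<in> ?Z" for z
  proof -
    show "z \<in> D" "conf_field F z = 0" using that interior_subset by (auto simp: conformal_point_iff)
    then show "z \<in> inside (path_image \<gamma>)" using zero_in by blast
  qed
  \<comment> \<open>The expression equals 4 at the boundary point \<gamma> 0, depends continuously
    on the point and omits 0; as D is connected, it stays positive.\<close>
  have tr: "0 < 2 + f_x F z + g_y F z" if z: "z \<in> D" for z
  proof (rule ccontr)
    let ?T = "\<lambda>z. 2 + 2 * Re (wirtinger F z)"
    assume "\<not> ?thesis"
    then have neg: "?T z \<le> 0" using trace_eq[of F z] by simp
    have "F (\<gamma> s) = \<gamma> s" for s using fixed by (simp add: path_image_eq_range)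
    moreover have "\<gamma> 0 \<in> D" "\<gamma> 0 \<in> U" using on U(3) by auto
    ultimately have "Re (wirtinger F (\<gamma> 0)) = 1"
      by (intro derivative_on_fixed_loop(1) sm(1) det)
    then have pos: "?T (\<gamma> 0) = 4" by simp
    have "connected (?T ` D)"
      by (intro connected_continuous_image conD continuous_intros continuous_on_subset[OF sm(2)] U(3))
    moreover have "?T z \<in> ?T ` D" "?T (\<gamma> 0) \<in> ?T ` D" using z on by blast+
    ultimately have "{?T z..?T (\<gamma> 0)} \<subseteq> ?T ` D" by (rule connected_contains_Icc)
    moreover have "0 \<in> {?T z..?T (\<gamma> 0)}" using neg pos by simp
    ultimately obtain y where "y \<in> D" "?T y = 0" by auto
    moreover from this(2) have "2 + f_x F y + g_y F y = 0" using trace_eq[of F y] by linarith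
    ultimately show False using moderate unfolding moderate_def by blast
  qed
  have fill: "fillable (conf_field F) p (conf_index F p)" if p: "p \<in> ?Z" for p
  proof -
    \<comment> \<open>Finiteness isolates p from the other zeros, which the chart at p
      requires.\<close>
    have "finite (?Z - {p})" using fin by simp
    then have "open (- (?Z - {p}) \<inter> interior D)"
      by (intro open_Int open_Compl finite_imp_closed open_interior)
    moreover have "p \<in> - (?Z - {p}) \<inter> interior D" using p by blast
    ultimately obtain e where e: "0 < e" "ball p e \<subseteq> - (?Z - {p}) \<inter> interior D"
      using open_contains_ball by blast
    show ?thesis
    proof (rule fillable_conf_index[OF U(1,2) _ det tr e(1)])
      show "p \<in> U" "p \<in> D" "p \<in> D" using Z[OF p] U(3) by auto
      show "conf_field F z \<noteq> 0" if "z \<in> ball p e" "z \<noteq> p" for z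
      proof -
        have "z \<in> interior D" "z \<notin> ?Z" using that e(2) by blast+
        then show ?thesis by (simp add: conformal_point_iff)
      qed
    qed
  qed
  have "winding_number (conf_field F \<circ> \<gamma>) 0 = (\<Sum>p\<in>?Z. of_int (conf_index F p) * winding_number \<gamma> p)"
  proof (rule winding_number_eq_sum_indices[OF fin cD conD' path loop on(2)])
    show "path_image \<gamma> \<inter> ?Z = {}" using nz by blast
    show "continuous_on D (conf_field F)" using sm(3) U(3) continuous_on_subset by blast
  qed (use zero_in fill in auto)
  also have "\<dots> = (\<Sum>p\<in>?Z. of_int (conf_index F p))"
    by (intro sum.cong) (use winding_number_inside Z(3) in auto)
  also have "winding_number (conf_field F \<circ> \<gamma>) 0 = 2"
    by (rule winding_number_conf_field[OF U(1,2)]) (use on U(3) fixed det nz conformal_point_iff in auto)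
  finally have "of_int (\<Sum>p\<in>?Z. conf_index F p) = (of_int 2 :: complex)" by simp
  then show ?thesis by (simp only: of_int_eq_iff)
qed

end

theorem theorem4:
  fixes \<gamma> :: "real \<Rightarrow> complex" and F :: "complex \<Rightarrow> complex" and D :: "complex set"
  assumes "smooth_simple_closed_curve \<gamma>"
    and "D = path_image \<gamma> \<union> inside (path_image \<gamma>)"
    and "symplectomorphism D F"
    and "moderate D F"
    and "\<forall>z\<in>path_image \<gamma>. F z = z"
    and "\<forall>z\<in>path_image \<gamma>. \<not> conformal_point F z"
  shows "infinite {z \<in> interior D. conformal_point F z} \<or>
         (\<Sum>p\<in>{z \<in> interior D. conformal_point F z}. conf_index F p) \<ge> 2"
proof (cases "finite {z \<in> interior D. conformal_point F z}")
  case True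
  \<comment> \<open>All that is claimed depends on the curve only through its image, so the
    reparametrized curve may replace it. The index sum is then exactly 2.\<close>
  obtain \<gamma>' \<tau> where \<gamma>': "bottom_loop \<gamma>' \<tau>" "path_image \<gamma>' = path_image \<gamma>"
    using regular_loop.obtain_bottom_loop[OF smooth_curve_regular_loop[OF assms(1)]] by blast
  obtain U where U: "open U" "D \<subseteq> U" "smooth_on U F"
    using assms(3) unfolding symplectomorphism_def smooth_near_def by blast
  have "f_x F z * g_y F z - f_y F z * g_x F z = 1" if "z \<in> D" for z
    using assms(3) that unfolding symplectomorphism_def by blast
  then have "(\<Sum>p\<in>{z \<in> interior D. conformal_point F z}. conf_index F p) = 2"
    using bottom_loop.sum_conf_index[OF \<gamma>'(1), of D U F] \<gamma>'(2) assms U True by simp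
  then show ?thesis by simp
qed simp

end
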